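(* Let $T:\Omega\to\Omega$ be a $k$-to-$1$ uniformly expanding map of a compact metric space, and let $\beta\in(1,+\infty)$. For any potential $A\in\mathcal{C}^{\beta\log}(\Omega)$, the transfer operator $\mathscr{L}_{T,A}$ acting on $\mathcal{C}^{(\beta-1)\log}(\Omega)$ satisfies a Ruelle–Perron–Frobenius theorem and the RPF measure has at least polynomial decay of correlations of degree $\beta-1$.
   Context: $(\Omega,d)$ is a compact metric space. A $k$-to-$1$ map $T$ is uniformly expanding if there is $\lambda>1$ such that for all $x,y\in\Omega$ one can enumerate $T^{-1}(x)=\{x^1,\dots,x^k\}$ and $T^{-1}(y)=\{y^1,\dots,y^k\}$ so that $d(x^j,y^j)\le d(x,y)/\lambda$ for all $j$. For $\beta>0$, $\omega_{\beta\log}$ is a modulus of continuity (continuous, increasing, concave on $[0,\infty)$, vanishing at $0$) equal to $(\log\frac{r_0}{r})^{-\beta}$ for $r\in(0,1]$, where $r_0$ is a constant large enough to make it increasing and concave on $[0,1]$. $\mathcal{C}^{\beta\log}(\Omega)$ is the Banach space of $f:\Omega\to\mathbb{R}$ with $|f(x)-f(y)|\le C\omega_{\beta\log}(d(x,y))$ for some $C$ (least such $C$ denoted $\mathrm{Hol}_{\beta\log}(f)$), with norm $\|f\|_\infty+\mathrm{Hol}_{\beta\log}(f)$. Transfer operator: $\mathscr{L}_{T,A}f(x)=\sum_{T(y)=x}e^{A(y)}f(y)$. It satisfies a Ruelle–Perron–Frobenius (RPF) theorem on a Banach space $\mathcal{X}$ of functions on which it acts continuously if there exist a positive $h\in\mathcal{X}$,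 a constant $\rho>0$ and a nonzero positive finite measure $\nu$ with $\mathscr{L}_{T,A}h=\rho h$ and $\mathscr{L}_{T,A}^*\nu=\rho\nu$ (i.e. $\int\mathscr{L}_{T,A}f\,d\nu=\rho\int f\,d\nu$ for all $f\in\mathcal{X}$). The RPF measure is the probability measure $\mu_A$ with $d\mu_A=h\,d\nu$, $h$ suitably scaled. At least polynomial decay of correlations of degree $\beta-1$: there is $C$ such that for all $f\in\mathcal{C}^{(\beta-1)\log}(\Omega)$, $g\in L^1(\mu_A)$ and $t\ge1$, $\left|\int f\cdot g\circ T^t\,d\mu_A-\int f\,d\mu_A\int g\,d\mu_A\right|\le C\,\mathrm{Hol}_{(\beta-1)\log}(f)\,\|g\|_{L^1(\mu_A)}/t^{\beta-1}$. *)

theory Defs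
  imports "HOL-Probability.Probability"
begin

definition k_to_one :: "nat \<Rightarrow> ('a \<Rightarrow> 'a) \<Rightarrow> bool" where
  "k_to_one k T \<longleftrightarrow> (\<forall>x. finite (T -` {x}) \<and> card (T -` {x}) = k)"

definition uniformly_expanding :: "nat \<Rightarrow> ('a::metric_space \<Rightarrow> 'a) \<Rightarrow> bool" where
  "uniformly_expanding k T \<longleftrightarrow>
     (\<exists>\<Lambda>>1. \<forall>x y. \<exists>xs ys.
        bij_betw xs {1..k} (T -` {x}) \<and> bij_betw ys {1..k} (T -` {y}) \<and>
        (\<forall>j\<in>{1..k}. dist (xs j) (ys j) \<le> dist x y / \<Lambda>))"

text \<open>
  The function \<open>\<omega>\<close> is one of the admissible choices for the modulus of
  exponent \<open>\<beta>\<close>: neither the constant \<open>r0\<close> nor the values beyond \<open>1\<close> are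
  prescribed. Monotonicity is not required to be strict, so that moduli which are
  constant beyond \<open>1\<close> are included. The condition \<open>r0 > 1\<close> makes the logarithm
  positive on the whole of \<open>(0,1]\<close>.
\<close>

definition log_modulus :: "real \<Rightarrow> (real \<Rightarrow> real) \<Rightarrow> bool" where
  "log_modulus \<beta> \<omega> \<longleftrightarrow>
     continuous_on {0..} \<omega> \<and> mono_on {0..} \<omega> \<and> concave_on {0..} \<omega> \<and> \<omega> 0 = 0 \<and>
     (\<exists>r0>1. \<forall>r\<in>{0<..1}. \<omega> r = ln (r0 / r) powr (-\<beta>))"

definition holder_space :: "(real \<Rightarrow> real) \<Rightarrow> ('a::metric_space \<Rightarrow> real) set" where
  "holder_space \<omega> = {f. \<exists>C. \<forall>x y. \<bar>f x - f y\<bar> \<le> C * \<omega> (dist x y)}"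

text \<open>
  For \<open>f\<close> in the space the infimum is attained. The constraint \<open>0 \<le> C\<close> only matters
  on a one-point space, where every real number would be an admissible constant.
\<close>

definition holder_const :: "(real \<Rightarrow> real) \<Rightarrow> ('a::metric_space \<Rightarrow> real) \<Rightarrow> real" where
  "holder_const \<omega> f = Inf {C. 0 \<le> C \<and> (\<forall>x y. \<bar>f x - f y\<bar> \<le> C * \<omega> (dist x y))}"

definition holder_norm :: "(real \<Rightarrow> real) \<Rightarrow> ('a::metric_space \<Rightarrow> real) \<Rightarrow> real" where
  "holder_norm \<omega> f = (SUP x. \<bar>f x\<bar>) + holder_const \<omega> f"

definition transfer_operator ::
    "('a \<Rightarrow> 'a) \<Rightarrow> ('a \<Rightarrow> real) \<Rightarrow> ('a \<Rightarrow> real) \<Rightarrow> 'a \<Rightarrow> real" where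
  "transfer_operator T A f x = (\<Sum>y\<in>T -` {x}. exp (A y) * f y)"

definition acts_continuously ::
    "('a \<Rightarrow> real) set \<Rightarrow> (('a \<Rightarrow> real) \<Rightarrow> real) \<Rightarrow> (('a \<Rightarrow> real) \<Rightarrow> 'a \<Rightarrow> real) \<Rightarrow> bool" where
  "acts_continuously X N L \<longleftrightarrow>
     (\<forall>f\<in>X. L f \<in> X) \<and>
     (\<forall>f\<in>X. \<forall>\<epsilon>>0. \<exists>\<delta>>0. \<forall>g\<in>X.
        N (\<lambda>x. g x - f x) < \<delta> \<longrightarrow> N (\<lambda>x. L g x - L f x) < \<epsilon>)"

definition rpf_triple ::
    "('a::topological_space \<Rightarrow> real) set \<Rightarrow> (('a \<Rightarrow> real) \<Rightarrow> 'a \<Rightarrow> real) \<Rightarrow>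
     ('a \<Rightarrow> real) \<Rightarrow> real \<Rightarrow> 'a measure \<Rightarrow> bool" where
  "rpf_triple X L h \<rho> \<nu> \<longleftrightarrow>
     h \<in> X \<and> (\<forall>x. 0 < h x) \<and> 0 < \<rho> \<and>
     sets \<nu> = sets borel \<and> finite_measure \<nu> \<and> emeasure \<nu> (space \<nu>) \<noteq> 0 \<and>
     (\<forall>x. L h x = \<rho> * h x) \<and>
     (\<forall>f\<in>X. (\<integral>x. L f x \<partial>\<nu>) = \<rho> * (\<integral>x. f x \<partial>\<nu>))"

definition satisfies_RPF ::
    "('a::topological_space \<Rightarrow> real) set \<Rightarrow> (('a \<Rightarrow> real) \<Rightarrow> real) \<Rightarrow>
     (('a \<Rightarrow> real) \<Rightarrow> 'a \<Rightarrow> real) \<Rightarrow> bool" where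
  "satisfies_RPF X N L \<longleftrightarrow>
     acts_continuously X N L \<and> (\<exists>h \<rho> \<nu>. rpf_triple X L h \<rho> \<nu>)"

text \<open>
  The scaling of \<open>h\<close> is absorbed in the choice of the triple, since positive multiples
  of \<open>h\<close> yield triples again.
\<close>

definition RPF_measure ::
    "('a::topological_space \<Rightarrow> real) set \<Rightarrow> (('a \<Rightarrow> real) \<Rightarrow> 'a \<Rightarrow> real) \<Rightarrow>
     'a measure \<Rightarrow> bool" where
  "RPF_measure X L \<mu> \<longleftrightarrow>
     (\<exists>h \<rho> \<nu>. rpf_triple X L h \<rho> \<nu> \<and> \<mu> = density \<nu> (\<lambda>x. ennreal (h x))) \<and> prob_space \<mu>"

definition polynomial_decay ::
    "('a::metric_space \<Rightarrow> 'a) \<Rightarrow> 'a measure \<Rightarrow> (real \<Rightarrow> real) \<Rightarrow> real \<Rightarrow> bool" where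
  "polynomial_decay T \<mu> \<omega> \<alpha> \<longleftrightarrow>
     (\<exists>C. \<forall>f\<in>holder_space \<omega>. \<forall>g :: 'a \<Rightarrow> real. integrable \<mu> g \<longrightarrow> (\<forall>t\<ge>1.
        \<bar>(\<integral>x. f x * g ((T ^^ t) x) \<partial>\<mu>) - (\<integral>x. f x \<partial>\<mu>) * (\<integral>x. g x \<partial>\<mu>)\<bar>
          \<le> C * holder_const \<omega> f * (\<integral>x. \<bar>g x\<bar> \<partial>\<mu>) / real t powr \<alpha>))"

end

theory Submission
  imports Defs
begin

text \<open>
  Along paired inverse branches, Birkhoff sums of \<open>A\<close> differ by at most a constant times
  \<open>(\<Sum>j. \<omega> (r / \<Lambda> ^ j))\<close>, which is of order \<open>w r\<close> for the modulus \<open>w\<close> of exponent \<open>\<beta> - 1\<close>.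
  Hence all iterates \<open>L ^ n\<close> satisfy one distortion bound. It forces \<open>L ^ n 1\<close> to be comparable to
  \<open>\<rho> ^ n\<close>, from which an eigenfunction \<open>h\<close> arises by monotone limits. For the normalized operators
  \<open>P n f = L ^ n (h f) / (\<rho> ^ n h)\<close> the distortion bound yields a uniform bound for the seminorm of
  \<open>P n f\<close> and \<open>osc (P n f) \<le> \<gamma> osc f + O(w (\<Lambda> ^ (-n)))\<close> with \<open>\<gamma> < 1\<close>; together they give
  \<open>osc (P n f) = O(n powr -(\<beta> - 1))\<close>. So \<open>P n f\<close> tends to a constant, which is a positive
  functional of \<open>f\<close> and thus the integral against a measure \<open>\<mu>\<close>, and \<open>\<nu> = \<mu> / h\<close> is conformal.
  For an arbitrary triple, duality turns the correlation into the integral of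
  \<open>(P t f - \<integral> f d\<mu>) g\<close>, and the decay of oscillations applies.
\<close>

subsection \<open>Logarithmic moduli of continuity\<close>

text \<open>At radius \<open>\<Lambda> ^ (-j)\<close> the modulus of the potential is only of order
  \<open>j powr (-\<beta>)\<close>, so the distortion series behaves like the integral of a power,
  and integrating costs one unit of the exponent. The same slowness rules out iterating a
  fixed-length contraction: smoothing for \<open>n\<close> steps leaves an error that is itself only
  polynomially small in \<open>n\<close>, so the number of smoothing steps has to grow with the
  total time. Two features of the claim shape the second half. An RPF measure may come from any
  triple, not only from the constructed one, so the estimates are developed for an arbitrary
  positive eigenfunction in \<open>X\<close>. The observable \<open>g\<close> is merely integrable,
  whereas the normalized operators are controlled on continuous functions; duality is therefore
  turned into an equality of measures, a push-forward against a density, which can then be tested on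
  every integrable \<open>g\<close>. This rests on continuity of \<open>T\<close>, which is derived
  from the pairing of fibres.\<close>

lemma log_modulus_nonneg:
  assumes "log_modulus \<beta> \<omega>" "0 \<le> r" shows "0 \<le> \<omega> r"
  using assms unfolding log_modulus_def mono_on_def
  by (metis atLeast_iff order_refl)

lemma log_modulus_mono:
  assumes "log_modulus \<beta> \<omega>" "0 \<le> r" "r \<le> s" shows "\<omega> r \<le> \<omega> s"
  using assms unfolding log_modulus_def mono_on_def by auto

lemma log_modulus_pos:
  assumes "log_modulus \<beta> \<omega>" "0 < r" shows "0 < \<omega> r"
proof -
  from assms(1) obtain r0 where r0: "r0 > 1" "\<And>r. r \<in> {0<..1} \<Longrightarrow> \<omega> r = ln (r0 / r) powr (-\<beta>)"
    unfolding log_modulus_def by blast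
  have m: "min r 1 \<in> {0<..1}" using assms(2) by auto
  have "r0 / min r 1 > 1" using r0(1) m by (simp add: field_simps)
  then have "\<omega> (min r 1) > 0" using r0(2)[OF m] ln_gt_zero[of "r0 / min r 1"] powr_gt_zero by (metis less_irrefl)
  moreover have "\<omega> (min r 1) \<le> \<omega> r" using log_modulus_mono[OF assms(1)] m by auto
  ultimately show ?thesis by linarith
qed

text \<open>Concavity between \<open>0\<close> and \<open>m * r\<close>, together with the value
  \<open>0\<close> at \<open>0\<close>. This is what carries estimates from \<open>(0,1]\<close>,
  where the logarithmic formula holds, to all radii up to the diameter.\<close>

lemma log_modulus_scale:
  assumes "log_modulus \<beta> \<omega>" "1 \<le> m" "0 \<le> r" shows "\<omega> (m * r) \<le> m * \<omega> r"
proof -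
  have c: "concave_on {0..} \<omega>" and z: "\<omega> 0 = 0" using assms(1) unfolding log_modulus_def by auto
  have "(1 - 1/m) * \<omega> 0 + (1/m) * \<omega> (m * r) \<le> \<omega> ((1 - 1/m) * 0 + (1/m) * (m * r))"
    using concave_onD[OF c, of "1/m" 0 "m*r"] assms(2,3) by simp
  then show ?thesis using assms(2) z by (simp add: field_simps)
qed

text \<open>The mean value theorem for \<open>x powr (-\<alpha>)\<close>: a discrete form of
  comparing a sum with the integral of a power, arranged so that the bounds telescope.\<close>

lemma powr_telescope:
  fixes x c \<alpha> :: real
  assumes "0 < x" "0 < c" "0 < \<alpha>"
  shows "(x + c) powr (-(\<alpha> + 1)) \<le> (x powr (-\<alpha>) - (x + c) powr (-\<alpha>)) / (\<alpha> * c)"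
proof -
  have "\<exists>z. x < z \<and> z < x + c \<and>
      (x + c) powr (-\<alpha>) - x powr (-\<alpha>) = (x + c - x) * (-\<alpha> * z powr (-\<alpha> - 1))"
    using assms by (intro MVT2) (auto intro!: derivative_eq_intros simp: field_simps powr_diff)
  then obtain z where z: "x < z" "z < x + c"
    "(x + c) powr (-\<alpha>) - x powr (-\<alpha>) = c * (-\<alpha> * z powr (-\<alpha> - 1))" by auto
  have "(x + c) powr (-(\<alpha> + 1)) \<le> z powr (-(\<alpha> + 1))"
    using z assms by (intro powr_mono2') auto
  also have "\<dots> = (x powr (-\<alpha>) - (x + c) powr (-\<alpha>)) / (\<alpha> * c)"
    using z(3) assms by (simp add: field_simps minus_diff_commute)
  finally show ?thesis .
qed

text \<open>For \<open>r \<le> 1\<close> put \<open>l = ln (r0 / r)\<close> and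
  \<open>c = ln \<Lambda>\<close>. The terms are \<open>(l + (j + 1) * c) powr (-\<beta>)\<close>,
  and telescoping bounds their sum by \<open>l powr (-(\<beta> - 1)) / ((\<beta> - 1) * c)\<close>,
  which is the modulus of exponent \<open>\<beta> - 1\<close> up to its normalizing
  constant.\<close>

lemma log_modulus_sum_le:
  assumes "1 < \<beta>" "log_modulus \<beta> \<omega>" "log_modulus (\<beta> - 1) w" "1 < \<Lambda>" "0 \<le> D"
  shows "\<exists>C\<ge>0. \<forall>r n. 0 \<le> r \<longrightarrow> r \<le> D \<longrightarrow> (\<Sum>j<n. \<omega> (r / \<Lambda> ^ Suc j)) \<le> C * w r"
proof -
  obtain r0 where r0: "r0 > 1" "\<And>r. r \<in> {0<..1} \<Longrightarrow> \<omega> r = ln (r0 / r) powr (-\<beta>)"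
    using assms(2) unfolding log_modulus_def by blast
  obtain r1 where r1: "r1 > 1" "\<And>r. r \<in> {0<..1} \<Longrightarrow> w r = ln (r1 / r) powr (-(\<beta>-1))"
    using assms(3) unfolding log_modulus_def by blast
  have zero: "\<omega> 0 = 0" "w 0 = 0" using assms(2,3) unfolding log_modulus_def by auto
  define c where "c = ln \<Lambda>"
  define \<alpha> where "\<alpha> = \<beta> - 1"
  \<comment> \<open>The two moduli may have different constants \<open>r0\<close> and
    \<open>r1\<close>; this \<open>m\<close> ensures
    \<open>ln (r1 / r) \<le> m * ln (r0 / r)\<close> on all of \<open>(0,1]\<close>.\<close>
  define m where "m = max 1 (ln r1 / ln r0)"
  define D' where "D' = max 1 D"
  define C where "C = m powr \<alpha> / (\<alpha> * c)"
  have c: "0 < c" using assms(4) by (simp add: c_def)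
  have \<alpha>: "0 < \<alpha>" using assms(1) by (simp add: \<alpha>_def)
  have m1: "m \<ge> 1" by (simp add: m_def)
  have C0: "0 \<le> C" using c \<alpha> by (simp add: C_def)
  have small: "(\<Sum>j<n. \<omega> (r / \<Lambda> ^ Suc j)) \<le> C * w r" if r: "0 < r" "r \<le> 1" for r n
  proof -
    define l where "l = ln (r0 / r)"
    have l_eq: "l = ln r0 - ln r" using r0(1) r by (simp add: l_def ln_div)
    have l0: "0 < l" using l_eq r0(1) r ln_gt_zero[of r0] ln_le_zero_iff[of r] by linarith
    have terms: "\<omega> (r / \<Lambda> ^ Suc j) = (l + real (Suc j) * c) powr (-(\<alpha>+1))" for j
    proof -
      have "\<Lambda> ^ Suc j \<ge> 1" using assms(4) by (intro one_le_power) auto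
      then have "r / \<Lambda> ^ Suc j \<in> {0<..1}" using r assms(4) by (auto simp: divide_simps)
      moreover have "ln (r0 / (r / \<Lambda> ^ Suc j)) = l + real (Suc j) * c"
        using r r0(1) assms(4) by (simp add: l_def c_def ln_div ln_mult ln_realpow algebra_simps)
      ultimately show ?thesis using r0(2) by (simp add: \<alpha>_def)
    qed
    have "(\<Sum>j<n. \<omega> (r / \<Lambda> ^ Suc j)) \<le>
        (\<Sum>j<n. ((l + real j * c) powr (-\<alpha>) - (l + real (Suc j) * c) powr (-\<alpha>)) / (\<alpha> * c))"
    proof (intro sum_mono)
      fix j
      have "l + real j * c > 0" using l0 c by (simp add: add_pos_nonneg)
      from powr_telescope[OF this c \<alpha>] show "\<omega> (r / \<Lambda> ^ Suc j) \<le>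
          ((l + real j * c) powr (-\<alpha>) - (l + real (Suc j) * c) powr (-\<alpha>)) / (\<alpha> * c)"
        unfolding terms by (simp add: algebra_simps)
    qed
    also have "\<dots> = (l powr (-\<alpha>) - (l + real n * c) powr (-\<alpha>)) / (\<alpha> * c)"
      using sum_lessThan_telescope'[of "\<lambda>j. (l + real j * c) powr (-\<alpha>)" n]
      by (simp flip: sum_divide_distrib)
    also have "\<dots> \<le> l powr (-\<alpha>) / (\<alpha> * c)"
      using c \<alpha> by (intro divide_right_mono) auto
    also have "\<dots> \<le> (m powr \<alpha> * w r) / (\<alpha> * c)"
    proof (intro divide_right_mono)
      define l' where "l' = ln (r1 / r)"
      have l'_eq: "l' = ln r1 - ln r" using r1(1) r by (simp add: l'_def ln_div)
      have l'0: "0 < l'" using l'_eq r1(1) r ln_gt_zero[of r1] ln_le_zero_iff[of r] by linarith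
      have "ln r1 = ln r1 / ln r0 * ln r0" using r0(1) by simp
      also have "\<dots> \<le> m * ln r0" using r0(1) by (intro mult_right_mono) (auto simp: m_def)
      finally have "ln r1 \<le> m * ln r0" .
      moreover have "- ln r \<le> m * (- ln r)"
        using mult_right_mono[OF m1, of "- ln r"] r ln_le_zero_iff[of r] by simp
      ultimately have "l' \<le> m * l" unfolding l_eq l'_eq by (simp add: algebra_simps)
      then have "(m * l) powr (-\<alpha>) \<le> l' powr (-\<alpha>)" using l'0 \<alpha> by (intro powr_mono2') auto
      then have "m powr \<alpha> * (m * l) powr (-\<alpha>) \<le> m powr \<alpha> * l' powr (-\<alpha>)"
        by (intro mult_left_mono) auto
      moreover have "m powr \<alpha> * (m * l) powr (-\<alpha>) = l powr (-\<alpha>)"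
        using m1 l0 by (simp add: powr_mult powr_minus)
      moreover have "w r = l' powr (-\<alpha>)" using r1(2)[of r] r by (simp add: l'_def \<alpha>_def)
      ultimately show "l powr (-\<alpha>) \<le> m powr \<alpha> * w r" by simp
    qed (use c \<alpha> in auto)
    finally show ?thesis by (simp add: C_def)
  qed
  have "(\<Sum>j<n. \<omega> (r / \<Lambda> ^ Suc j)) \<le> D' * C * w r" if r: "0 \<le> r" "r \<le> D" for r n
  proof (cases "r = 0")
    case False
    have D': "D' \<ge> 1" "D \<le> D'" by (auto simp: D'_def)
    \<comment> \<open>Radii above \<open>1\<close> are shrunk by \<open>D'\<close> at the price of a
      factor \<open>D'\<close> in each term; shrinking the argument of \<open>w\<close> back is free
      by monotonicity.\<close>
    have "(\<Sum>j<n. \<omega> (r / \<Lambda> ^ Suc j)) \<le> (\<Sum>j<n. D' * \<omega> (r / D' / \<Lambda> ^ Suc j))"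
    proof (intro sum_mono)
      fix j
      have "\<omega> (D' * (r / D' / \<Lambda> ^ Suc j)) \<le> D' * \<omega> (r / D' / \<Lambda> ^ Suc j)"
        using D' r assms(4) by (intro log_modulus_scale[OF assms(2)]) auto
      then show "\<omega> (r / \<Lambda> ^ Suc j) \<le> D' * \<omega> (r / D' / \<Lambda> ^ Suc j)" using D' by simp
    qed
    also have "\<dots> \<le> D' * (C * w (r / D'))"
      using small[of "r / D'" n] r D' False
      by (auto simp flip: sum_distrib_left intro!: mult_left_mono simp: divide_simps)
    also have "\<dots> \<le> D' * (C * w r)"
      using r D' C0 divide_left_mono[of 1 D' r]
      by (intro mult_left_mono log_modulus_mono[OF assms(3)]) auto
    finally show ?thesis by simp
  qed (simp add: zero)
  moreover have "0 \<le> D' * C" using C0 by (simp add: D'_def)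
  ultimately show ?thesis by blast
qed

text \<open>Along a geometric sequence of radii the logarithm is affine in \<open>n\<close>, with
  slope \<open>ln \<Lambda>\<close>. This is the source of the polynomial rate.\<close>

lemma log_modulus_decay:
  assumes "0 < \<alpha>" "log_modulus \<alpha> w" "1 < \<Lambda>" "0 \<le> D"
  shows "\<exists>C\<ge>0. \<forall>n\<ge>1. w (D / \<Lambda> ^ n) \<le> C * real n powr (-\<alpha>)"
proof -
  obtain r0 where r0: "r0 > 1" "\<And>r. r \<in> {0<..1} \<Longrightarrow> w r = ln (r0 / r) powr (-\<alpha>)"
    using assms(2) unfolding log_modulus_def by blast
  define D' where "D' = max 1 D"
  have D': "1 \<le> D'" "D \<le> D'" by (auto simp: D'_def)
  have "w (D / \<Lambda> ^ n) \<le> D' * ln \<Lambda> powr (-\<alpha>) * real n powr (-\<alpha>)" if "n \<ge> 1" for n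
  proof -
    have p: "\<Lambda> ^ n \<ge> 1" using assms(3) by (intro one_le_power) auto
    have "w (D / \<Lambda> ^ n) \<le> w (D' * (1 / \<Lambda> ^ n))"
      using D' assms(3,4) by (intro log_modulus_mono[OF assms(2)]) (auto simp: divide_right_mono)
    also have "\<dots> \<le> D' * w (1 / \<Lambda> ^ n)"
      using D' assms(3) by (intro log_modulus_scale[OF assms(2)]) auto
    also have "w (1 / \<Lambda> ^ n) = (ln r0 + real n * ln \<Lambda>) powr (-\<alpha>)"
      using r0 p assms(3) by (subst r0(2)) (auto simp: ln_mult ln_realpow divide_simps)
    also have "\<dots> \<le> (real n * ln \<Lambda>) powr (-\<alpha>)"
      using r0(1) assms(1,3) that by (intro powr_mono2') auto
    also have "\<dots> = ln \<Lambda> powr (-\<alpha>) * real n powr (-\<alpha>)"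
      using assms(3) by (simp add: powr_mult)
    finally show ?thesis using D' by (simp add: mult_left_mono mult.assoc)
  qed
  moreover have "0 \<le> D' * ln \<Lambda> powr (-\<alpha>)" using D' by simp
  ultimately show ?thesis by blast
qed

text \<open>By concavity \<open>w r / r\<close> is nonincreasing, so its smallest value on
  \<open>(0,D]\<close> is taken at \<open>D\<close>. Consequently Lipschitz functions belong to the
  space.\<close>

lemma le_log_modulus:
  assumes "log_modulus \<alpha> w" "0 < D" "0 \<le> r" "r \<le> D"
  shows "r \<le> D / w D * w r"
proof (cases "r = 0")
  case True
  then show ?thesis using assms(1) by (simp add: log_modulus_def)
next
  case False
  have "w (D / r * r) \<le> D / r * w r"
    using assms False by (intro log_modulus_scale[OF assms(1)]) (auto simp: field_simps)
  then show ?thesis using False assms log_modulus_pos[OF assms(1,2)] by (simp add: field_simps)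
qed

subsection \<open>Positive functionals on function rings over a compact metric space\<close>

text \<open>The parent locale is the setting of the Stone-Weierstrass theorem. Truncation and
  Lipschitz functions are added to approximate indicators of open sets and to cut a function into
  horizontal layers.\<close>

locale lipschitz_ring = function_ring_on X UNIV for X :: "('a::metric_space \<Rightarrow> real) set" +
  assumes min_const: "f \<in> X \<Longrightarrow> (\<lambda>x. min (f x) c) \<in> X"
    and lipschitz: "(\<And>x y. \<bar>f x - f y\<bar> \<le> C * dist x y) \<Longrightarrow> f \<in> X"
begin

lemma scale: "f \<in> X \<Longrightarrow> (\<lambda>x. c * f x) \<in> X"
  using mult[OF const] .

lemma sum_lessThan: "(\<And>i. f i \<in> X) \<Longrightarrow> (\<lambda>x. \<Sum>i<n. f i x) \<in> X" for n :: nat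
  by (induction n) (auto intro: const add)

lemma borel: "f \<in> X \<Longrightarrow> f \<in> borel_measurable borel"
  using continuous borel_measurable_continuous_onI by blast

lemma bound:
  fixes f :: "'a \<Rightarrow> real"
  assumes "continuous_on UNIV f"
  obtains B where "0 < B" "\<And>x. \<bar>f x\<bar> \<le> B"
proof -
  have "bounded (range f)"
    using compact_imp_bounded[OF compact_continuous_image[OF assms compact]] .
  then show ?thesis using that by (auto simp: bounded_pos)
qed

lemma integrable:
  fixes f :: "'a \<Rightarrow> real"
  assumes "finite_measure M" "sets M = sets borel" "continuous_on UNIV f"
  shows "integrable M f"
proof -
  interpret finite_measure M by fact
  obtain B where "\<And>x. \<bar>f x\<bar> \<le> B" using bound[OF assms(3)] by blast
  moreover have "f \<in> borel_measurable M"
    using borel_measurable_continuous_onI[OF assms(3)] measurable_cong_sets[OF assms(2) refl] by blast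
  ultimately show ?thesis by (intro integrable_const_bound[of _ B]) auto
qed

text \<open>Truncated multiples of the distance to the complement. Starting at the zero function
  lets the successive increments sum to the indicator, as needed for the splitting of
  covers.\<close>

lemma open_approximation:
  assumes "open U"
  obtains u :: "nat \<Rightarrow> 'a \<Rightarrow> real" where "\<And>n. u n \<in> X" "\<And>n x. 0 \<le> u n x" "\<And>n x. u n x \<le> 1"
    "\<And>x. incseq (\<lambda>n. u n x)" "\<And>x. (\<lambda>n. u n x) \<longlonglongrightarrow> indicator U x" "u 0 = (\<lambda>_. 0)"
\<comment> \<open>\<open>infdist\<close> to the empty set is \<open>0\<close> by convention, so the
  distance formula would give the wrong limit on the whole space.\<close>
proof (cases "U = UNIV")
  case True
  show ?thesis
  proof (rule that[of "\<lambda>n x. if n = 0 then 0 else 1"])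
    show "(\<lambda>n. if n = 0 then 0 else 1 :: real) \<longlonglongrightarrow> indicator U x" for x
      by (rule tendsto_eventually) (auto simp: True intro!: eventually_sequentiallyI[of 1])
  qed (auto simp: const incseq_def)
next
  case False
  let ?u = "\<lambda>(n::nat) x. min (real n * infdist x (- U)) 1"
  show ?thesis
  proof (rule that[of ?u])
    show "?u n \<in> X" for n
      by (intro min_const scale lipschitz[of _ 1]) (use infdist_triangle_abs in auto)
    show "incseq (\<lambda>n. ?u n x)" for x
      by (intro monoI min.mono mult_right_mono) (auto simp: infdist_nonneg)
    show "(\<lambda>n. ?u n x) \<longlonglongrightarrow> indicator U x" for x
    proof (cases "x \<in> U")
      case True
      have "infdist x (- U) \<noteq> 0"
        using in_closed_iff_infdist_zero[of "- U" x] assms False True by auto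
      then have "infdist x (- U) > 0" using infdist_nonneg[of x "- U"] by linarith
      then obtain N where "1 < real N * infdist x (- U)"
        using reals_Archimedean3 by blast
      then have "1 \<le> real n * infdist x (- U)" if "n \<ge> N" for n
        using that infdist_nonneg[of x "- U"] mult_right_mono[of "real N" "real n" "infdist x (- U)"] by auto
      then show ?thesis using True
        by (intro tendsto_eventually eventually_sequentiallyI[of N]) (simp add: min_absorb2)
    qed simp
  qed (auto simp: infdist_nonneg)
qed

text \<open>Dominated convergence along the approximants recovers the measure of open sets, a
  generator stable under intersection. It later identifies a push-forward with a density from
  integrals over the ring alone.\<close>

lemma measure_eqI_integral:
  assumes "finite_measure M" "finite_measure N" "sets M = sets borel" "sets N = sets borel"
    and eq: "\<And>f. f \<in> X \<Longrightarrow> (\<integral>x. f x \<partial>M) = (\<integral>x. f x \<partial>N)"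
  shows "M = N"
proof -
  have lim: "(\<lambda>n. \<integral>x. u n x \<partial>K) \<longlonglongrightarrow> measure K U"
    if K: "finite_measure K" "sets K = sets borel" and U: "open U"
      and u: "\<And>n. u n \<in> X" "\<And>n x. 0 \<le> u n x" "\<And>n x. u n x \<le> 1"
        "\<And>x. (\<lambda>n. u n x) \<longlonglongrightarrow> indicator U x" for K U and u :: "nat \<Rightarrow> 'a \<Rightarrow> real"
  proof -
    have sp: "space K = UNIV" using sets_eq_imp_space_eq[OF K(2)] by simp
    have "U \<in> sets K" using K U by simp
    have "(\<lambda>n. \<integral>x. u n x \<partial>K) \<longlonglongrightarrow> (\<integral>x. indicator U x \<partial>K)"
    proof (rule integral_dominated_convergence[where w = "\<lambda>_. 1"])
      show "(indicator U :: 'a \<Rightarrow> real) \<in> borel_measurable K" using \<open>U \<in> sets K\<close> by simp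
      show "u n \<in> borel_measurable K" for n
        using borel[OF u(1)] measurable_cong_sets[OF K(2) refl] by blast
      show "integrable K (\<lambda>_. 1::real)"
        using K(1) by (simp add: finite_measure.integrable_const)
    qed (use u in auto)
    then show ?thesis using sp by simp
  qed
  show ?thesis
  proof (rule measure_eqI_generator_eq[where E = "{U. open U}" and \<Omega> = UNIV and A = "\<lambda>_. UNIV"])
    fix U :: "'a set" assume "U \<in> {U. open U}"
    then have U: "open U" by simp
    obtain u :: "nat \<Rightarrow> 'a \<Rightarrow> real" where u: "\<And>n. u n \<in> X" "\<And>n x. 0 \<le> u n x" "\<And>n x. u n x \<le> 1"
      "\<And>x. incseq (\<lambda>n. u n x)" "\<And>x. (\<lambda>n. u n x) \<longlonglongrightarrow> indicator U x" "u 0 = (\<lambda>_. 0)"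
      by (rule open_approximation[OF U], rule that)
    have "measure M U = measure N U"
      using lim[OF assms(1,3) U u(1-3,5)] lim[OF assms(2,4) U u(1-3,5)] eq[OF u(1)] LIMSEQ_unique by simp
    then show "emeasure M U = emeasure N U"
      using assms(1,2) by (simp add: finite_measure.emeasure_eq_measure)
  next
    show "sets M = sigma_sets UNIV {U. open U}" "sets N = sigma_sets UNIV {U. open U}"
      using assms(3,4) by (simp_all add: sets_borel)
    show "emeasure M UNIV \<noteq> \<infinity>" for i
      using finite_measure.emeasure_finite[OF assms(1)] by simp
  qed (auto simp: Int_stable_def)
qed

text \<open>The Daniell-style outer measure charges countable covers by nonnegative functions of the ring,
  which makes countable subadditivity automatic; compactness enters only in showing that the
  whole space keeps mass one.\<close>

definition cover :: "'a set \<Rightarrow> (nat \<Rightarrow> 'a \<Rightarrow> real) \<Rightarrow> bool" where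
  "cover E F \<longleftrightarrow> (\<forall>i. F i \<in> X \<and> (\<forall>x. 0 \<le> F i x)) \<and> (\<forall>x\<in>E. 1 \<le> (\<Sum>i. ennreal (F i x)))"

end

section \<open>Representation of a positive functional by Caratheodory's construction\<close>

locale positive_functional = lipschitz_ring +
  fixes \<Phi> :: "('a \<Rightarrow> real) \<Rightarrow> real"
  assumes \<Phi>_add: "f \<in> X \<Longrightarrow> g \<in> X \<Longrightarrow> \<Phi> (\<lambda>x. f x + g x) = \<Phi> f + \<Phi> g"
    and \<Phi>_scale: "f \<in> X \<Longrightarrow> \<Phi> (\<lambda>x. c * f x) = c * \<Phi> f"
    and \<Phi>_nonneg: "f \<in> X \<Longrightarrow> (\<And>x. 0 \<le> f x) \<Longrightarrow> 0 \<le> \<Phi> f"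
    and \<Phi>_one: "\<Phi> (\<lambda>_. 1) = 1"
begin

lemma \<Phi>_const: "\<Phi> (\<lambda>_. c) = c"
  using \<Phi>_scale[OF const, of c 1] \<Phi>_one by simp

lemma \<Phi>_diff: "f \<in> X \<Longrightarrow> g \<in> X \<Longrightarrow> \<Phi> (\<lambda>x. f x - g x) = \<Phi> f - \<Phi> g"
  using \<Phi>_add[of f "\<lambda>x. -1 * g x"] \<Phi>_scale[of g "-1"] scale[of g "-1"] by simp

lemma \<Phi>_mono: "f \<in> X \<Longrightarrow> g \<in> X \<Longrightarrow> (\<And>x. f x \<le> g x) \<Longrightarrow> \<Phi> f \<le> \<Phi> g"
  using \<Phi>_nonneg[of "\<lambda>x. g x - f x"] \<Phi>_diff[of g f] diff[of g f] by simp

lemma \<Phi>_sum: "(\<And>i. f i \<in> X) \<Longrightarrow> \<Phi> (\<lambda>x. \<Sum>i<n. f i x) = (\<Sum>i<n. \<Phi> (f i))" for n :: nat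
  by (induction n) (auto simp: \<Phi>_const \<Phi>_add sum_lessThan)

definition outer :: "'a set \<Rightarrow> ennreal" where
  "outer E = (INF F\<in>{F. cover E F}. \<Sum>i. ennreal (\<Phi> (F i)))"

lemma outer_le: "cover E F \<Longrightarrow> outer E \<le> (\<Sum>i. ennreal (\<Phi> (F i)))"
  unfolding outer_def by (rule INF_lower) simp

lemma outer_le_single:
  assumes "g \<in> X" "\<And>x. 0 \<le> g x" "\<And>x. x \<in> E \<Longrightarrow> 1 \<le> g x"
  shows "outer E \<le> ennreal (\<Phi> g)"
proof -
  let ?F = "\<lambda>i::nat. if i = 0 then g else (\<lambda>_. 0)"
  have "(\<Sum>i. ennreal (?F i x)) = ennreal (g x)" for x
    by (subst suminf_finite[of "{0}"]) auto
  then have "cover E ?F" using assms by (auto simp: cover_def const)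
  then have "outer E \<le> (\<Sum>i. ennreal (\<Phi> (?F i)))" by (rule outer_le)
  also have "\<dots> = ennreal (\<Phi> g)" by (subst suminf_finite[of "{0}"]) (auto simp: \<Phi>_const)
  finally show ?thesis .
qed

text \<open>Doubly indexed covers arise twice: when covers of countably many sets are merged, and
  when each member of a cover is split into increments.\<close>

lemma outer_le_2dimen:
  assumes "\<And>i j. G i j \<in> X" "\<And>i j x. 0 \<le> G i j x"
    and "\<And>x. x \<in> E \<Longrightarrow> 1 \<le> (\<Sum>i. \<Sum>j. ennreal (G i j x))"
  shows "outer E \<le> (\<Sum>i. \<Sum>j. ennreal (\<Phi> (G i j)))"
proof -
  let ?F = "\<lambda>k. case prod_decode k of (i, j) \<Rightarrow> G i j"
  have "(\<Sum>k. ennreal (?F k x)) = (\<Sum>i. \<Sum>j. ennreal (G i j x))" for x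
    using suminf_ennreal_2dimen[of "\<lambda>i. \<Sum>j. ennreal (G i j x)" "\<lambda>(i, j). ennreal (G i j x)"]
    by (simp add: case_prod_unfold)
  then have "cover E ?F" using assms by (auto simp: cover_def case_prod_unfold)
  then have "outer E \<le> (\<Sum>k. ennreal (\<Phi> (?F k)))" by (rule outer_le)
  also have "\<dots> = (\<Sum>i. \<Sum>j. ennreal (\<Phi> (G i j)))"
    using suminf_ennreal_2dimen[of "\<lambda>i. \<Sum>j. ennreal (\<Phi> (G i j))" "\<lambda>(i, j). ennreal (\<Phi> (G i j))"]
    by (simp add: case_prod_unfold)
  finally show ?thesis .
qed

lemma outer_mono: "E \<subseteq> E' \<Longrightarrow> outer E \<le> outer E'"
  unfolding outer_def by (rule INF_superset_mono) (auto simp: cover_def subset_iff)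

text \<open>The lower bound is a Dini argument: the open sets where a partial sum exceeds
  \<open>1 - e\<close> exhaust the space, so by compactness one partial sum exceeds
  \<open>1 - e\<close> everywhere, and positivity applies to that finite sum.\<close>

lemma outer_UNIV: "outer UNIV = 1"
proof (rule antisym)
  show "outer UNIV \<le> 1" using outer_le_single[of "\<lambda>_. 1" UNIV] by (simp add: const \<Phi>_one)
  show "1 \<le> outer UNIV"
    unfolding outer_def
  proof (rule INF_greatest)
    fix F assume "F \<in> {F. cover UNIV F}"
    then have F: "\<And>i. F i \<in> X" "\<And>i x. 0 \<le> F i x" "\<And>x. 1 \<le> (\<Sum>i. ennreal (F i x))"
      by (auto simp: cover_def)
    show "1 \<le> (\<Sum>i. ennreal (\<Phi> (F i)))"
    proof (rule ennreal_le_epsilon)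
      fix e :: real assume e: "0 < e"
      define V where "V n = {x. 1 - e < (\<Sum>i<n. F i x)}" for n
      have open_V: "open (V n)" for n
        unfolding V_def by (intro open_Collect_less continuous_on_const continuous[OF sum_lessThan] F)
      have "\<exists>n. x \<in> V n" for x
      \<comment> \<open>\<open>ennreal\<close> sends negative reals to \<open>0\<close>, so
        comparisons there would lose strictness; in this case the empty sum already exceeds
        \<open>1 - e\<close>.\<close>
      proof (cases "1 - e < 0")
        case True then show ?thesis by (intro exI[of _ 0]) (simp add: V_def)
      next
        case False
        have "ennreal (1 - e) < 1" using e False by (simp add: ennreal_less_one_iff)
        also have "1 \<le> (\<Sum>i. ennreal (F i x))" by (rule F)
        finally have "ennreal (1 - e) < (SUP n. \<Sum>i<n. ennreal (F i x))"
          by (simp add: suminf_eq_SUP)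
        then obtain n where "ennreal (1 - e) < (\<Sum>i<n. ennreal (F i x))"
          by (auto simp: less_SUP_iff)
        then show ?thesis using F(2) False
          by (intro exI[of _ n]) (simp add: V_def sum_ennreal ennreal_less_iff)
      qed
      then have "UNIV \<subseteq> (\<Union>n. V n)" by blast
      then obtain C' where C': "finite C'" "UNIV \<subseteq> (\<Union>n\<in>C'. V n)"
        by (rule compactE_image[OF compact open_V])
      define N where "N = Max (insert 0 C')"
      have "1 - e \<le> (\<Sum>i<N. F i x)" for x
      proof -
        obtain n where n: "n \<in> C'" "x \<in> V n" using C'(2) by blast
        have "n \<le> N" using n C'(1) by (simp add: N_def)
        then have "(\<Sum>i<n. F i x) \<le> (\<Sum>i<N. F i x)" using F(2) by (intro sum_mono2) auto
        then show ?thesis using n(2) by (simp add: V_def)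
      qed
      then have "\<Phi> (\<lambda>_. 1 - e) \<le> \<Phi> (\<lambda>x. \<Sum>i<N. F i x)"
        by (intro \<Phi>_mono const sum_lessThan F)
      then have "1 - e \<le> (\<Sum>i<N. \<Phi> (F i))" by (simp add: \<Phi>_const \<Phi>_sum F(1))
      then have "ennreal (1 - e) \<le> (\<Sum>i<N. ennreal (\<Phi> (F i)))"
        using F by (simp add: sum_ennreal \<Phi>_nonneg ennreal_leI)
      also have "\<dots> \<le> (\<Sum>i. ennreal (\<Phi> (F i)))" by (intro sum_le_suminf) auto
      finally have "ennreal (1 - e) + ennreal e \<le> (\<Sum>i. ennreal (\<Phi> (F i))) + ennreal e"
        by (rule add_right_mono)
      moreover have "1 \<le> ennreal (1 - e) + ennreal e"
        using e by (cases "e \<le> 1") (auto simp flip: ennreal_plus ennreal_1 simp: ennreal_leI add_increasing)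
      ultimately show "1 \<le> (\<Sum>i. ennreal (\<Phi> (F i))) + ennreal e" by (rule order_trans[rotated])
    qed
  qed
qed

lemma outer_measure_space_outer: "outer_measure_space UNIV outer"
  unfolding outer_measure_space_def
proof (intro conjI)
  show "positive UNIV outer"
    using outer_le_single[of "\<lambda>_. 0" "{}"] by (simp add: positive_def const \<Phi>_const)
  show "increasing UNIV outer" using outer_mono by (simp add: increasing_def)
  show "countably_subadditive UNIV outer"
    unfolding countably_subadditive_def
  proof (intro allI impI)
    fix E :: "nat \<Rightarrow> 'a set"
    show "outer (\<Union>i. E i) \<le> (\<Sum>i. outer (E i))"
    proof (rule ennreal_le_epsilon)
      fix e :: real assume e: "0 < e"
      have "\<exists>F. cover (E n) F \<and> (\<Sum>i. ennreal (\<Phi> (F i))) \<le> outer (E n) + ennreal (e * (1/2) ^ Suc n)" for n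
      proof -
        \<comment> \<open>Finiteness makes the added error strict, which is what produces a
          near-optimal cover from the infimum.\<close>
        have "outer (E n) < top"
          using le_less_trans[OF _ ennreal_one_less_top] outer_mono[of "E n" UNIV] outer_UNIV by simp
        then have "outer (E n) < outer (E n) + ennreal (e * (1/2) ^ Suc n)"
          using e by (cases "outer (E n)") (auto simp flip: ennreal_plus simp: ennreal_less_iff)
        then show ?thesis unfolding outer_def[of "E n"] INF_less_iff by (auto intro: less_imp_le)
      qed
      then obtain G where G: "\<And>n. cover (E n) (G n)"
        "\<And>n. (\<Sum>i. ennreal (\<Phi> (G n i))) \<le> outer (E n) + ennreal (e * (1/2) ^ Suc n)" by metis
      have "outer (\<Union>i. E i) \<le> (\<Sum>n. \<Sum>i. ennreal (\<Phi> (G n i)))"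
      proof (rule outer_le_2dimen)
        fix x assume "x \<in> (\<Union>i. E i)"
        then obtain m where "x \<in> E m" by blast
        then have "1 \<le> (\<Sum>i. ennreal (G m i x))" using G(1) by (auto simp: cover_def)
        also have "\<dots> = (\<Sum>n\<in>{m}. \<Sum>i. ennreal (G n i x))" by simp
        also have "\<dots> \<le> (\<Sum>n. \<Sum>i. ennreal (G n i x))" by (intro sum_le_suminf) auto
        finally show "1 \<le> (\<Sum>n. \<Sum>i. ennreal (G n i x))" .
      qed (use G(1) in \<open>auto simp: cover_def\<close>)
      also have "\<dots> \<le> (\<Sum>n. outer (E n) + ennreal (e * (1/2) ^ Suc n))"
        by (intro suminf_le G) auto
      also have "\<dots> = (\<Sum>n. outer (E n)) + (\<Sum>n. ennreal (e * (1/2) ^ Suc n))"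
        by (intro suminf_add[symmetric]) auto
      also have "(\<Sum>n. ennreal (e * (1/2) ^ Suc n)) = ennreal e"
        using e sums_mult[OF power_half_series, of e] by (intro suminf_ennreal_eq) auto
      finally show "outer (\<Union>i. E i) \<le> (\<Sum>i. outer (E i)) + ennreal e" .
    qed
  qed
qed

text \<open>A cover \<open>F\<close> of \<open>E\<close> is split by the partition
  \<open>u N\<close>, \<open>1 - u N\<close>. The second part covers \<open>E - U\<close> because
  \<open>u N\<close> vanishes off \<open>U\<close>; the first part, cut further into increments of
  \<open>u\<close>, covers \<open>U \<inter> E\<close> in the limit of large
  \<open>N\<close>.\<close>

lemma open_in_lambda_system:
  assumes "open U"
  shows "U \<in> lambda_system UNIV UNIV outer"
proof -
  obtain u :: "nat \<Rightarrow> 'a \<Rightarrow> real" where u: "\<And>n. u n \<in> X" "\<And>n x. 0 \<le> u n x" "\<And>n x. u n x \<le> 1"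
    "\<And>x. incseq (\<lambda>n. u n x)" "\<And>x. (\<lambda>n. u n x) \<longlonglongrightarrow> indicator U x" "u 0 = (\<lambda>_. 0)"
    by (rule open_approximation[OF assms], rule that)
  define v where "v n x = u (Suc n) x - u n x" for n x
  have v: "v n \<in> X" "0 \<le> v n x" for n x
    using diff[OF u(1) u(1)] incseq_SucD[OF u(4)] by (auto simp: v_def[abs_def])
  have v_sum: "(\<Sum>n. ennreal (v n x)) = ennreal (indicator U x)" for x
    using telescope_sums[OF u(5)[of x]] v(2) u(6) by (intro suminf_ennreal_eq) (auto simp: v_def)
  have u0: "u n x = 0" if "x \<notin> U" for n x
    using incseq_le[OF u(4) u(5), of n x] u(2)[of n x] that by simp
  have "outer (U \<inter> E) + outer ((UNIV - U) \<inter> E) \<le> outer E" for E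
    unfolding outer_def[of E]
  proof (rule INF_greatest)
    fix F assume "F \<in> {F. cover E F}"
    then have F: "\<And>i. F i \<in> X" "\<And>i x. 0 \<le> F i x" "\<And>x. x \<in> E \<Longrightarrow> 1 \<le> (\<Sum>i. ennreal (F i x))"
      by (auto simp: cover_def)
    have Fv: "(\<lambda>x. F i x * v n x) \<in> X" for i n by (intro mult F v)
    have Fu: "\<Phi> (\<lambda>x. F i x * u N x) = (\<Sum>n<N. \<Phi> (\<lambda>x. F i x * v n x))" for i N
    proof -
      have "(\<lambda>x. F i x * u N x) = (\<lambda>x. \<Sum>n<N. F i x * v n x)"
      proof
        fix x
        show "F i x * u N x = (\<Sum>n<N. F i x * v n x)"
          using u(6) sum_lessThan_telescope[of "\<lambda>n. u n x" N] by (simp add: v_def flip: sum_distrib_left)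
      qed
      then show ?thesis by (simp add: \<Phi>_sum[OF Fv])
    qed
    have step: "(\<Sum>i. \<Sum>n<N. ennreal (\<Phi> (\<lambda>x. F i x * v n x))) + outer ((UNIV - U) \<inter> E)
        \<le> (\<Sum>i. ennreal (\<Phi> (F i)))" for N
    proof -
      have X1: "(\<lambda>x. F i x * (1 - u N x)) \<in> X" for i by (intro mult F diff const u)
      have "cover ((UNIV - U) \<inter> E) (\<lambda>i x. F i x * (1 - u N x))"
        using F u(3) u0 X1 by (auto simp: cover_def)
      then have "outer ((UNIV - U) \<inter> E) \<le> (\<Sum>i. ennreal (\<Phi> (\<lambda>x. F i x * (1 - u N x))))"
        by (rule outer_le)
      then have "(\<Sum>i. \<Sum>n<N. ennreal (\<Phi> (\<lambda>x. F i x * v n x))) + outer ((UNIV - U) \<inter> E) \<le>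
         (\<Sum>i. ennreal (\<Phi> (\<lambda>x. F i x * u N x))) + (\<Sum>i. ennreal (\<Phi> (\<lambda>x. F i x * (1 - u N x))))"
        using Fv F(2) v(2) by (simp add: Fu sum_ennreal \<Phi>_nonneg add_left_mono)
      also have "\<dots> = (\<Sum>i. ennreal (\<Phi> (\<lambda>x. F i x * u N x)) + ennreal (\<Phi> (\<lambda>x. F i x * (1 - u N x))))"
        by (intro suminf_add) auto
      also have "\<dots> = (\<Sum>i. ennreal (\<Phi> (F i)))"
      proof (intro suminf_cong)
        fix i
        have a: "(\<lambda>x. F i x * u N x) \<in> X" by (intro mult F u)
        have "\<Phi> (F i) = \<Phi> (\<lambda>x. F i x * u N x) + \<Phi> (\<lambda>x. F i x * (1 - u N x))"
          using \<Phi>_add[OF a X1[of i]] by (simp add: algebra_simps)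
        moreover have "0 \<le> \<Phi> (\<lambda>x. F i x * u N x)" "0 \<le> \<Phi> (\<lambda>x. F i x * (1 - u N x))"
          using a X1 F(2) u(2,3) by (auto intro!: \<Phi>_nonneg)
        ultimately show "ennreal (\<Phi> (\<lambda>x. F i x * u N x)) + ennreal (\<Phi> (\<lambda>x. F i x * (1 - u N x)))
            = ennreal (\<Phi> (F i))" by simp
      qed
      finally show ?thesis .
    qed
    \<comment> \<open>On \<open>U\<close> the increments \<open>v n\<close> sum to one, so all
      products together form a cover. The bound \<open>step\<close> involves only finitely many
      increments; the supremum over \<open>N\<close> closes the gap.\<close>
    have "outer (U \<inter> E) \<le> (\<Sum>i. \<Sum>n. ennreal (\<Phi> (\<lambda>x. F i x * v n x)))"
    proof (rule outer_le_2dimen)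
      fix x assume x: "x \<in> U \<inter> E"
      then have "(\<Sum>i. \<Sum>n. ennreal (F i x * v n x)) = (\<Sum>i. ennreal (F i x))"
        using F(2) v(2) v_sum[of x] by (simp add: ennreal_mult)
      then show "1 \<le> (\<Sum>i. \<Sum>n. ennreal (F i x * v n x))" using F(3) x by simp
    qed (use Fv F(2) v(2) in auto)
    also have "\<dots> = (SUP N. \<Sum>i. \<Sum>n<N. ennreal (\<Phi> (\<lambda>x. F i x * v n x)))"
      unfolding suminf_eq_SUP[of "\<lambda>n. ennreal (\<Phi> (\<lambda>x. F _ x * v n x))"]
      by (intro ennreal_suminf_SUP_eq) (auto simp: incseq_def intro!: sum_mono2)
    finally have "outer (U \<inter> E) + outer ((UNIV - U) \<inter> E) \<le>
        (SUP N. \<Sum>i. \<Sum>n<N. ennreal (\<Phi> (\<lambda>x. F i x * v n x))) + outer ((UNIV - U) \<inter> E)"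
      by (rule add_right_mono)
    also have "\<dots> = (SUP N. (\<Sum>i. \<Sum>n<N. ennreal (\<Phi> (\<lambda>x. F i x * v n x))) + outer ((UNIV - U) \<inter> E))"
      by (intro ennreal_SUP_add_left[symmetric]) auto
    also have "\<dots> \<le> (\<Sum>i. ennreal (\<Phi> (F i)))" by (intro SUP_least step)
    finally show "outer (U \<inter> E) + outer ((UNIV - U) \<inter> E) \<le> (\<Sum>i. ennreal (\<Phi> (F i)))" .
  qed
  moreover have "outer E \<le> outer (U \<inter> E) + outer ((UNIV - U) \<inter> E)" for E
  proof -
    interpret algebra UNIV "UNIV :: 'a set set" using algebra_Pow[of UNIV] by simp
    have "subadditive UNIV outer"
      using countably_subadditive_subadditive outer_measure_space_outer
      by (auto simp: outer_measure_space_def)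
    then have "outer ((U \<inter> E) \<union> ((UNIV - U) \<inter> E)) \<le> outer (U \<inter> E) + outer ((UNIV - U) \<inter> E)"
      by (rule subadditiveD) auto
    moreover have "(U \<inter> E) \<union> ((UNIV - U) \<inter> E) = E" by blast
    ultimately show ?thesis by simp
  qed
  ultimately show ?thesis unfolding lambda_system_def by (auto intro: antisym)
qed

text \<open>Only the upper bound needs work, for functions with values in \<open>[0,1]\<close>:
  applied to \<open>1 - f\<close> as well, it yields equality, and an affine change of variable
  gives the general case.\<close>

theorem representing_measure:
  obtains M where "prob_space M" "sets M = sets borel" "\<And>f. f \<in> X \<Longrightarrow> (\<integral>x. f x \<partial>M) = \<Phi> f"
proof -
  define M :: "'a measure" where "M = measure_of UNIV (sets borel) outer"
  interpret P: sigma_algebra UNIV "UNIV :: 'a set set" using sigma_algebra_Pow[of UNIV] by simp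
  have ms: "measure_space UNIV (lambda_system UNIV UNIV outer) outer"
    by (rule P.caratheodory_lemma[OF outer_measure_space_outer])
  have "sets (borel :: 'a measure) \<subseteq> lambda_system UNIV UNIV outer"
    unfolding sets_borel
    using ms open_in_lambda_system
    by (intro sigma_algebra.sigma_sets_subset) (auto simp: measure_space_def)
  then have ms': "measure_space UNIV (sets (borel :: 'a measure)) outer"
    using measure_down[OF ms] sets.sigma_algebra_axioms[of "borel :: 'a measure"] by simp
  have sets: "sets M = sets borel"
    unfolding M_def using sets.sets_measure_of_eq[of borel] by simp
  have em: "emeasure M E = outer E" if "E \<in> sets borel" for E
    using that ms' unfolding M_def measure_space_def
    by (intro emeasure_measure_of_sigma) auto
  have space: "space M = UNIV" using sets_eq_imp_space_eq[OF sets] by simp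
  interpret prob_space M
    by (rule prob_spaceI) (simp add: space em outer_UNIV)
  have integ: "integrable M f" if "continuous_on UNIV f" for f :: "'a \<Rightarrow> real"
    using integrable[OF _ sets that] finite_measure_axioms by blast
  have upper: "(\<integral>x. f x \<partial>M) \<le> \<Phi> f" if f: "f \<in> X" "\<And>x. 0 \<le> f x" "\<And>x. f x \<le> 1" for f
  proof (rule field_le_epsilon)
    fix e :: real assume "0 < e"
    then obtain k where k: "inverse (real (Suc k)) < e" using reals_Archimedean by blast
    define n where "n = real (Suc k)"
    have n: "0 < n" by (simp add: n_def)
    \<comment> \<open>Layers of height \<open>1 / n\<close>: the increment
      \<open>q (Suc i) - q i\<close> vanishes off \<open>S i\<close>, lies between \<open>0\<close>
      and \<open>1 / n\<close>, and equals \<open>1 / n\<close> on \<open>S (Suc i)\<close>.\<close>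
    define q where "q i x = min (f x) (real i / n)" for i x
    define S where "S i = {x. real i / n < f x}" for i
    have q: "q i \<in> X" for i unfolding q_def[abs_def] by (rule min_const[OF f(1)])
    have S: "S i \<in> sets M" for i
      unfolding S_def sets using continuous[OF f(1)]
      by (intro borel_open open_Collect_less continuous_on_const)
    have le_Suc: "real i / n \<le> real (Suc i) / n" for i using n by (intro divide_right_mono) auto
    have q_mono: "q i x \<le> q (Suc i) x" for i x
      unfolding q_def by (intro min.mono order_refl le_Suc)
    have Suc_n: "real (Suc i) / n = real i / n + 1 / n" for i by (simp add: add_divide_distrib)
    have q0: "q 0 = (\<lambda>_. 0)" using f(2) by (auto simp: q_def)
    have qSuc: "q (Suc k) = f" using f(3) n by (auto simp: q_def n_def)
    have "f x \<le> (\<Sum>i<Suc k. indicator (S i) x / n)" for x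
    proof -
      have "f x = (\<Sum>i<Suc k. q (Suc i) x - q i x)"
        using sum_lessThan_telescope[of "\<lambda>i. q i x" "Suc k"] qSuc q0 by (simp del: sum.lessThan_Suc)
      also have "\<dots> \<le> (\<Sum>i<Suc k. indicator (S i) x / n)"
      proof (rule sum_mono)
        fix i
        show "q (Suc i) x - q i x \<le> indicator (S i) x / n"
        proof (cases "real i / n < f x")
          case True
          then show ?thesis using Suc_n[of i] by (simp add: q_def S_def)
        next
          case False
          then show ?thesis using le_Suc[of i] by (simp add: q_def S_def)
        qed
      qed
      finally show ?thesis .
    qed
    then have "(\<integral>x. f x \<partial>M) \<le> (\<integral>x. (\<Sum>i<Suc k. indicator (S i) x / n) \<partial>M)"
      using integ[OF continuous[OF f(1)]] S
      by (intro integral_mono Bochner_Integration.integrable_sum integrable_divide integrable_real_indicator)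
        (auto simp: emeasure_eq_measure)
    also have "\<dots> = (\<Sum>i<Suc k. measure M (S i) / n)"
      using S by (subst Bochner_Integration.integral_sum)
        (auto intro!: integrable_divide integrable_real_indicator simp: emeasure_eq_measure space)
    \<comment> \<open>The integral is bounded through \<open>S i\<close>, whereas the cover estimate
      for the \<open>i\<close>-th layer concerns \<open>S (Suc i)\<close>. The shift leaves over
      \<open>S 0\<close>, whose contribution of at most \<open>1 / n\<close> is the error.\<close>
    also have "\<dots> = measure M (S 0) / n + (\<Sum>i<k. measure M (S (Suc i)) / n)"
      by (rule sum.lessThan_Suc_shift)
    also have "\<dots> \<le> 1 / n + (\<Sum>i<k. \<Phi> (q (Suc i)) - \<Phi> (q i))"
    proof (intro add_mono divide_right_mono prob_le_1 sum_mono)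
      fix i
      let ?g = "\<lambda>x. n * (q (Suc i) x - q i x)"
      have g: "?g \<in> X" by (intro scale diff q)
      have g0: "0 \<le> ?g x" for x using q_mono n by simp
      have "outer (S (Suc i)) \<le> ennreal (\<Phi> ?g)"
      proof (rule outer_le_single[OF g g0])
        fix x assume "x \<in> S (Suc i)"
        then have "1 / n \<le> q (Suc i) x - q i x"
          using Suc_n[of i] by (simp add: S_def q_def)
        then show "1 \<le> ?g x" using n by (simp add: field_simps)
      qed
      then have "emeasure M (S (Suc i)) \<le> ennreal (\<Phi> ?g)"
        using S[of "Suc i"] em sets by simp
      moreover have "0 \<le> \<Phi> ?g" by (intro \<Phi>_nonneg g g0)
      ultimately have "measure M (S (Suc i)) \<le> \<Phi> ?g" by (simp add: emeasure_eq_measure)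
      also have "\<dots> = n * (\<Phi> (q (Suc i)) - \<Phi> (q i))" by (simp add: \<Phi>_scale \<Phi>_diff diff q)
      finally show "measure M (S (Suc i)) / n \<le> \<Phi> (q (Suc i)) - \<Phi> (q i)"
        using n by (simp add: field_simps)
    qed (use n in auto)
    also have "(\<Sum>i<k. \<Phi> (q (Suc i)) - \<Phi> (q i)) = \<Phi> (q k)"
      using sum_lessThan_telescope[of "\<lambda>i. \<Phi> (q i)" k] by (simp add: q0 \<Phi>_const)
    also have "\<Phi> (q k) \<le> \<Phi> f" by (intro \<Phi>_mono q f) (simp add: q_def)
    finally show "(\<integral>x. f x \<partial>M) \<le> \<Phi> f + e" using k by (simp add: n_def inverse_eq_divide)
  qed
  have unit: "(\<integral>x. f x \<partial>M) = \<Phi> f" if f: "f \<in> X" "\<And>x. 0 \<le> f x" "\<And>x. f x \<le> 1" for f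
    using upper[OF f] upper[of "\<lambda>x. 1 - f x"] f diff[OF const f(1), of 1] integ[OF continuous[OF f(1)]]
    by (simp add: \<Phi>_diff const \<Phi>_one prob_space)
  have "(\<integral>x. f x \<partial>M) = \<Phi> f" if f: "f \<in> X" for f
  proof -
    obtain B where B: "0 < B" "\<And>x. \<bar>f x\<bar> \<le> B" by (rule bound[OF continuous[OF f]], rule that)
    let ?g = "\<lambda>x. 1 / (2 * B) * (f x + B)"
    have "(\<integral>x. ?g x \<partial>M) = \<Phi> ?g"
    proof (rule unit)
      show "?g \<in> X" by (intro scale add f const)
      show "0 \<le> ?g x" "?g x \<le> 1" for x using B(1) B(2)[of x] by (auto simp: field_simps)
    qed
    moreover have "\<Phi> ?g = 1 / (2 * B) * (\<Phi> f + B)"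
      by (subst \<Phi>_scale[OF add[OF f const]]) (simp add: \<Phi>_add f const \<Phi>_const)
    moreover have "(\<integral>x. ?g x \<partial>M) = 1 / (2 * B) * ((\<integral>x. f x \<partial>M) + B)"
      using integ[OF continuous[OF f]] by (simp add: prob_space)
    ultimately show ?thesis using B(1) by simp
  qed
  then show ?thesis using that prob_space_axioms sets by blast
qed

end

subsection \<open>Transfer operators with uniform distortion\<close>

lemma exp_diff_le: "0 \<le> t \<Longrightarrow> exp t - 1 \<le> t * exp t" for t :: real
  using exp_ge_add_one_self[of "-t"] mult_left_mono[of "1 - t" "exp (-t)" "exp t"]
  by (simp add: algebra_simps exp_minus)

text \<open>Comparison estimates are multiplicative and need nonnegative functions; subtracting the
  infimum provides these without enlarging the oscillation.\<close>

lemma oscillation_normalize: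
  fixes f :: "'a \<Rightarrow> real"
  assumes "\<And>x y. \<bar>f x - f y\<bar> \<le> W"
  obtains m where "\<And>x. 0 \<le> f x - m" "\<And>x. f x - m \<le> W"
proof -
  have lower: "f p - W \<le> f x" for p x using assms[of p x] by linarith
  then have "bdd_below (range f)" by (intro bdd_belowI2)
  then have "Inf (range f) \<le> f x" for x by (intro cInf_lower) auto
  moreover have "f x - W \<le> Inf (range f)" for x
    using lower by (intro cInf_greatest) auto
  ultimately show ?thesis using that[of "Inf (range f)"] by (simp add: algebra_simps)
qed

text \<open>The intervals from \<open>(x n - c) / n\<close> to \<open>(x n + c) / n\<close> meet
  pairwise, hence share a point, and any such point is a valid slope. Applied to logarithms of
  iterates it produces the logarithm of the eigenvalue.\<close>

lemma quasi_additive_linear: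
  fixes x :: "nat \<Rightarrow> real"
  assumes "\<And>m n. \<bar>x (m + n) - x m - x n\<bar> \<le> c"
  obtains \<theta> where "\<And>n. \<bar>x n - real n * \<theta>\<bar> \<le> c"
proof -
  have mult: "\<bar>x (Suc m * n) - real (Suc m) * x n\<bar> \<le> real m * c" for m n
  proof (induction m)
    case (Suc m)
    then show ?case using assms[of n "Suc m * n"] by (simp add: algebra_simps)
  qed simp
  have compare: "(x m - c) / real m \<le> (x n + c) / real n" if "1 \<le> m" "1 \<le> n" for m n
  proof -
    \<comment> \<open>The value at \<open>n * m\<close> is estimated as \<open>n\<close> copies of
      \<open>m\<close> and as \<open>m\<close> copies of \<open>n\<close>. The shift by one comes
      from \<open>mult\<close>, which counts \<open>Suc m\<close> copies.\<close>
    have 1: "x (n * m) \<ge> real n * x m - (real n - 1) * c" using mult[of "n - 1" m] that by simp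
    have 2: "x (n * m) \<le> real m * x n + (real m - 1) * c"
      using mult[of "m - 1" n] that by (simp add: mult.commute[of n])
    have "0 \<le> c" using order_trans[OF abs_ge_zero assms[of 0 0]] .
    with 1 2 have "real n * (x m - c) \<le> real m * (x n + c)" by (simp add: algebra_simps)
    then show ?thesis using that by (simp add: field_simps)
  qed
  define \<theta> where "\<theta> = (SUP m\<in>{1..}. (x m - c) / real m)"
  have "bdd_above ((\<lambda>m. (x m - c) / real m) ` {1..})"
    using compare[of _ 1] by (intro bdd_aboveI2[of _ _ "x 1 + c"]) simp
  then have lower: "(x n - c) / real n \<le> \<theta>" if "1 \<le> n" for n
    unfolding \<theta>_def using that by (intro cSUP_upper) auto
  have upper: "\<theta> \<le> (x n + c) / real n" if "1 \<le> n" for n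
    unfolding \<theta>_def using compare that by (intro cSUP_least) auto
  have "\<bar>x n - real n * \<theta>\<bar> \<le> c" for n
  proof (cases "n = 0")
    case True
    then show ?thesis using assms[of 0 0] by simp
  next
    case False
    then show ?thesis using lower[of n] upper[of n] by (simp add: field_simps abs_le_iff)
  qed
  then show ?thesis by (rule that)
qed

lemma holder_spaceI: "(\<And>x y. \<bar>f x - f y\<bar> \<le> H * w (dist x y)) \<Longrightarrow> f \<in> holder_space w"
  unfolding holder_space_def by blast

text \<open>Here \<open>\<omega>\<close> is the modulus of the potential and \<open>w\<close> that of the function space; the hypothesis
  \<open>sum_le\<close> is where one logarithmic exponent is lost.\<close>

locale expanding_transfer =
  fixes T :: "'a::metric_space \<Rightarrow> 'a" and A :: "'a \<Rightarrow> real" and \<omega> w :: "real \<Rightarrow> real"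
    and \<Lambda> D a b c \<kappa> \<alpha> :: real
  assumes compact: "compact (UNIV :: 'a set)"
    and finite_preimage: "finite (T -` {x})"
    and preimage_nonempty: "T -` {x} \<noteq> {}"
    and \<Lambda>: "1 < \<Lambda>"
    and pairing: "\<exists>\<sigma>. bij_betw \<sigma> (T -` {x}) (T -` {y}) \<and> (\<forall>z\<in>T -` {x}. dist z (\<sigma> z) \<le> dist x y / \<Lambda>)"
    and A_regular: "\<bar>A x - A y\<bar> \<le> a * \<omega> (dist x y)" and a: "0 \<le> a"
    and \<omega>_mono: "0 \<le> r \<Longrightarrow> r \<le> s \<Longrightarrow> \<omega> r \<le> \<omega> s"
    and w_mono: "0 \<le> r \<Longrightarrow> r \<le> s \<Longrightarrow> w r \<le> w s"
    and w_zero: "w 0 = 0" and w_pos: "0 < r \<Longrightarrow> 0 < w r"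
    and w_continuous: "continuous_on {0..} w"
    and D: "0 < D" and dist_le: "dist x y \<le> D"
    and sum_le: "0 \<le> r \<Longrightarrow> r \<le> D \<Longrightarrow> a * (\<Sum>j<n. \<omega> (r / \<Lambda> ^ Suc j)) \<le> b * w r" and b: "0 \<le> b"
    and le_w: "0 \<le> r \<Longrightarrow> r \<le> D \<Longrightarrow> r \<le> c * w r"
    and w_decay: "1 \<le> n \<Longrightarrow> w (D / \<Lambda> ^ n) \<le> \<kappa> * real n powr (-\<alpha>)"
    and \<kappa>: "0 \<le> \<kappa>" and \<alpha>: "0 < \<alpha>"
begin

abbreviation "X \<equiv> holder_space w :: ('a \<Rightarrow> real) set"
abbreviation "L \<equiv> transfer_operator T A"

lemma w_nonneg: "0 \<le> r \<Longrightarrow> 0 \<le> w r"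
  using w_mono[of 0 r] w_zero by simp

lemma holder_spaceE:
  assumes "f \<in> X"
  obtains H where "0 \<le> H" "\<And>x y. \<bar>f x - f y\<bar> \<le> H * w (dist x y)"
proof -
  from assms obtain C where C: "\<And>x y. \<bar>f x - f y\<bar> \<le> C * w (dist x y)"
    unfolding holder_space_def by blast
  have "\<bar>f x - f y\<bar> \<le> \<bar>C\<bar> * w (dist x y)" for x y
    using C[of x y] mult_right_mono[OF abs_ge_self[of C] w_nonneg[of "dist x y"]] by simp
  then show ?thesis using that[of "\<bar>C\<bar>"] by simp
qed

lemma holder_bounded:
  assumes "f \<in> X"
  obtains M where "0 \<le> M" "\<And>x. \<bar>f x\<bar> \<le> M"
proof -
  obtain H where H: "0 \<le> H" "\<And>x y. \<bar>f x - f y\<bar> \<le> H * w (dist x y)"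
    by (rule holder_spaceE[OF assms], rule that)
  define p :: 'a where "p = undefined"
  have "\<bar>f x\<bar> \<le> \<bar>f p\<bar> + H * w D" for x
  proof -
    have "\<bar>f x - f p\<bar> \<le> H * w D"
      using H(2)[of x p] mult_left_mono[OF w_mono[OF zero_le_dist dist_le[of x p]] H(1)] by linarith
    then show ?thesis by linarith
  qed
  moreover have "0 \<le> \<bar>f p\<bar> + H * w D" using H(1) w_nonneg D by simp
  ultimately show ?thesis using that by blast
qed

lemma lipschitz_imp_holder:
  assumes "\<And>x y. \<bar>f x - f y\<bar> \<le> C * dist x y"
  shows "f \<in> X"
proof (rule holder_spaceI)
  fix x y
  have "\<bar>f x - f y\<bar> \<le> \<bar>C\<bar> * dist x y"
    using assms[of x y] mult_right_mono[OF abs_ge_self[of C], of "dist x y"] by simp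
  also have "\<dots> \<le> \<bar>C\<bar> * (c * w (dist x y))"
    using le_w[of "dist x y"] dist_le by (intro mult_left_mono) auto
  finally show "\<bar>f x - f y\<bar> \<le> (\<bar>C\<bar> * c) * w (dist x y)" by simp
qed

text \<open>Products stay in the space because its members are bounded; distance functions lie in it
  by \<open>le_w\<close> and separate points.\<close>

sublocale X: lipschitz_ring X
proof
  show "compact (UNIV :: 'a set)" by (rule compact)
  show "(\<lambda>_. k) \<in> X" for k by (rule holder_spaceI[of _ 0]) simp
  show "f \<in> X" if "\<And>x y. \<bar>f x - f y\<bar> \<le> C * dist x y" for f C
    using lipschitz_imp_holder[OF that] .
next
  fix f :: "'a \<Rightarrow> real" assume "f \<in> X"
  then obtain H where H: "\<And>x y. \<bar>f x - f y\<bar> \<le> H * w (dist x y)" using holder_spaceE by blast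
  show "continuous_on UNIV f"
    unfolding continuous_on_def
  proof
    fix x :: 'a
    have "((\<lambda>y. w (dist y x)) \<longlongrightarrow> w 0) (at x)"
    proof (rule continuous_on_tendsto_compose[OF w_continuous])
      show "((\<lambda>y. dist y x) \<longlongrightarrow> 0) (at x)" by (simp add: tendsto_dist_iff[symmetric])
    qed auto
    then have "((\<lambda>y. H * w (dist y x)) \<longlongrightarrow> 0) (at x)"
      using tendsto_mult_right_zero w_zero by fastforce
    then have "((\<lambda>y. f y - f x) \<longlongrightarrow> 0) (at x)"
      by (rule Lim_null_comparison[rotated]) (use H in auto)
    then show "(f \<longlongrightarrow> f x) (at x within UNIV)" using Lim_null by blast
  qed
  show "(\<lambda>x. min (f x) k) \<in> X" for k
  proof (rule holder_spaceI)
    fix x y :: 'a show "\<bar>min (f x) k - min (f y) k\<bar> \<le> H * w (dist x y)"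
      using H[of x y] by (auto simp: min_def)
  qed
next
  fix f g :: "'a \<Rightarrow> real" assume fg: "f \<in> X" "g \<in> X"
  obtain H where H: "0 \<le> H" "\<And>x y. \<bar>f x - f y\<bar> \<le> H * w (dist x y)"
    by (rule holder_spaceE[OF fg(1)], rule that)
  obtain K where K: "0 \<le> K" "\<And>x y. \<bar>g x - g y\<bar> \<le> K * w (dist x y)"
    by (rule holder_spaceE[OF fg(2)], rule that)
  obtain M where M: "0 \<le> M" "\<And>x. \<bar>f x\<bar> \<le> M" by (rule holder_bounded[OF fg(1)], rule that)
  obtain N where N: "0 \<le> N" "\<And>x. \<bar>g x\<bar> \<le> N" by (rule holder_bounded[OF fg(2)], rule that)
  show "(\<lambda>x. f x + g x) \<in> X"
  proof (rule holder_spaceI)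
    fix x y
    have "\<bar>(f x + g x) - (f y + g y)\<bar> \<le> H * w (dist x y) + K * w (dist x y)"
      using H(2)[of x y] K(2)[of x y] by linarith
    then show "\<bar>(f x + g x) - (f y + g y)\<bar> \<le> (H + K) * w (dist x y)" by (simp add: algebra_simps)
  qed
  show "(\<lambda>x. f x * g x) \<in> X"
  proof (rule holder_spaceI)
    fix x y
    have "\<bar>f x * g x - f y * g y\<bar> = \<bar>f x * (g x - g y) + (f x - f y) * g y\<bar>"
      by (simp add: algebra_simps)
    also have "\<dots> \<le> \<bar>f x\<bar> * \<bar>g x - g y\<bar> + \<bar>f x - f y\<bar> * \<bar>g y\<bar>"
      by (metis abs_mult abs_triangle_ineq)
    also have "\<dots> \<le> M * (K * w (dist x y)) + (H * w (dist x y)) * N"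
      using H K M N w_nonneg by (intro add_mono mult_mono) auto
    finally show "\<bar>f x * g x - f y * g y\<bar> \<le> (M * K + H * N) * w (dist x y)"
      by (simp add: algebra_simps)
  qed
next
  fix x y :: 'a assume "x \<noteq> y"
  then show "\<exists>f\<in>X. f x \<noteq> f y"
    using abs_dist_diff_le[of _ x]
    by (intro bexI[of _ "\<lambda>z. dist z x"] lipschitz_imp_holder[of _ 1]) (auto simp: dist_commute[of x])
qed

section \<open>Linearity, positivity and distortion of the iterates\<close>

lemma L_add: "L (\<lambda>x. F x + G x) = (\<lambda>x. L F x + L G x)"
  by (auto simp: transfer_operator_def algebra_simps sum.distrib)

lemma L_scale: "L (\<lambda>x. k * F x) = (\<lambda>x. k * L F x)"
  by (auto simp: transfer_operator_def algebra_simps sum_distrib_left)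

lemma L_mono: "(\<And>x. F x \<le> G x) \<Longrightarrow> L F x \<le> L G x"
  by (auto simp: transfer_operator_def intro!: sum_mono mult_left_mono)

lemma L_abs_le: "\<bar>L F x\<bar> \<le> L (\<lambda>x. \<bar>F x\<bar>) x"
  unfolding transfer_operator_def
  by (rule order_trans[OF sum_abs]) (auto intro!: sum_mono simp: abs_mult)

lemma iterate_add: "(L ^^ n) (\<lambda>x. F x + G x) = (\<lambda>x. (L ^^ n) F x + (L ^^ n) G x)"
  by (induction n) (simp_all add: L_add)

lemma iterate_scale: "(L ^^ n) (\<lambda>x. k * F x) = (\<lambda>x. k * (L ^^ n) F x)"
  by (induction n) (simp_all add: L_scale)

lemma iterate_mono: "(\<And>x. F x \<le> G x) \<Longrightarrow> (L ^^ n) F x \<le> (L ^^ n) G x"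
  by (induction n arbitrary: x) (simp_all add: L_mono)

lemma iterate_nonneg: "(\<And>x. 0 \<le> F x) \<Longrightarrow> 0 \<le> (L ^^ n) F x"
  using iterate_mono[of "\<lambda>_. 0" F n x] iterate_scale[of n 0 F] by simp

lemma iterate_pos: "(\<And>x. 0 < F x) \<Longrightarrow> 0 < (L ^^ n) F x"
  by (induction n arbitrary: x)
    (simp_all add: transfer_operator_def finite_preimage preimage_nonempty sum_pos)

text \<open>Pairing preimages one step at a time avoids enumerating the inverse branches of the iterates.\<close>

lemma iterate_compare:
  assumes "0 \<le> r" "\<And>x y. dist x y \<le> r / \<Lambda> ^ n \<Longrightarrow> F x \<le> G y" "\<And>x. 0 \<le> G x" "dist x y \<le> r"
  shows "(L ^^ n) F x \<le> exp (a * (\<Sum>j<n. \<omega> (r / \<Lambda> ^ Suc j))) * (L ^^ n) G y"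
  using assms(1,2,4)
proof (induction n arbitrary: r x y)
  case 0
  then show ?case by simp
next
  case (Suc n)
  \<comment> \<open>One step back moves the pair to distance at most \<open>r / \<Lambda>\<close>
    and costs \<open>a * \<omega> (r / \<Lambda>)\<close>; the remaining \<open>n\<close> steps form
    the same sum started at that smaller radius.\<close>
  define S where "S = (\<Sum>j<n. \<omega> (r / \<Lambda> / \<Lambda> ^ Suc j))"
  have S: "(\<Sum>j<Suc n. \<omega> (r / \<Lambda> ^ Suc j)) = \<omega> (r / \<Lambda>) + S"
    unfolding S_def by (subst sum.lessThan_Suc_shift) simp
  obtain \<sigma> where \<sigma>: "bij_betw \<sigma> (T -` {x}) (T -` {y})"
    "\<And>z. z \<in> T -` {x} \<Longrightarrow> dist z (\<sigma> z) \<le> dist x y / \<Lambda>" using pairing by blast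
  have "(L ^^ Suc n) F x = (\<Sum>z\<in>T -` {x}. exp (A z) * (L ^^ n) F z)"
    by (simp add: transfer_operator_def[of _ _ "(L ^^ n) F"])
  also have "\<dots> \<le> (\<Sum>z\<in>T -` {x}. exp (a * (\<omega> (r / \<Lambda>) + S)) * (exp (A (\<sigma> z)) * (L ^^ n) G (\<sigma> z)))"
  proof (rule sum_mono)
    fix z assume z: "z \<in> T -` {x}"
    have d: "dist z (\<sigma> z) \<le> r / \<Lambda>"
      using \<sigma>(2)[OF z] divide_right_mono[OF Suc.prems(3), of \<Lambda>] \<Lambda> by linarith
    have 1: "(L ^^ n) F z \<le> exp (a * S) * (L ^^ n) G (\<sigma> z)"
      unfolding S_def using Suc.prems(1,2) \<Lambda> d by (intro Suc.IH) auto
    have "A z \<le> A (\<sigma> z) + a * \<omega> (r / \<Lambda>)"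
      using A_regular[of z "\<sigma> z"] mult_left_mono[OF \<omega>_mono[OF zero_le_dist d] a] by linarith
    then have 2: "exp (A z) \<le> exp (A (\<sigma> z)) * exp (a * \<omega> (r / \<Lambda>))" by (simp flip: exp_add)
    have "exp (A z) * (L ^^ n) F z \<le> exp (A z) * (exp (a * S) * (L ^^ n) G (\<sigma> z))"
      using 1 by simp
    also have "\<dots> \<le> (exp (A (\<sigma> z)) * exp (a * \<omega> (r / \<Lambda>))) * (exp (a * S) * (L ^^ n) G (\<sigma> z))"
      using 2 iterate_nonneg[OF assms(3)] by (intro mult_right_mono) auto
    finally show "exp (A z) * (L ^^ n) F z
        \<le> exp (a * (\<omega> (r / \<Lambda>) + S)) * (exp (A (\<sigma> z)) * (L ^^ n) G (\<sigma> z))"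
      by (simp add: algebra_simps exp_add)
  qed
  also have "\<dots> = exp (a * (\<omega> (r / \<Lambda>) + S)) * (\<Sum>z\<in>T -` {y}. exp (A z) * (L ^^ n) G z)"
    unfolding sum_distrib_left[symmetric] by (subst sum.reindex_bij_betw[OF \<sigma>(1)]) simp
  finally show ?case unfolding S by (simp add: transfer_operator_def[of _ _ "(L ^^ n) G"])
qed

lemma iterate_compare_w:
  assumes "0 \<le> r" "r \<le> D" "\<And>x y. dist x y \<le> r / \<Lambda> ^ n \<Longrightarrow> F x \<le> G y" "\<And>x. 0 \<le> G x" "dist x y \<le> r"
  shows "(L ^^ n) F x \<le> exp (b * w r) * (L ^^ n) G y"
proof -
  have "(L ^^ n) F x \<le> exp (a * (\<Sum>j<n. \<omega> (r / \<Lambda> ^ Suc j))) * (L ^^ n) G y"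
    using assms by (intro iterate_compare) auto
  also have "\<dots> \<le> exp (b * w r) * (L ^^ n) G y"
    using sum_le[OF assms(1,2)] iterate_nonneg[OF assms(4)] by (intro mult_right_mono) auto
  finally show ?thesis .
qed

lemma le_shrink: "0 \<le> r \<Longrightarrow> r / \<Lambda> ^ n \<le> r"
  using \<Lambda> by (simp add: divide_le_eq mult_le_cancel_left1 one_le_power)

lemma iterate_one_bound: "(L ^^ n) (\<lambda>_. 1) x \<le> exp (b * w (dist x y)) * (L ^^ n) (\<lambda>_. 1) y"
  by (rule iterate_compare_w) (auto simp: dist_le)

text \<open>Paired preimages differ in the value of \<open>f\<close> and in the weight; the relative
  change of weight is \<open>O(w (dist x y))\<close> and multiplies the sup bound. Keeping
  \<open>M\<close> and \<open>H\<close> separate gives both invariance of the space and boundedness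
  in its norm.\<close>

lemma L_holder:
  obtains K where "0 \<le> K" "\<forall>f M x. (\<forall>x. \<bar>f x\<bar> \<le> M) \<longrightarrow> \<bar>L f x\<bar> \<le> K * M"
    "\<forall>f M H x y. 0 \<le> H \<longrightarrow> (\<forall>x. \<bar>f x\<bar> \<le> M) \<longrightarrow> (\<forall>x y. \<bar>f x - f y\<bar> \<le> H * w (dist x y)) \<longrightarrow>
       \<bar>L f x - L f y\<bar> \<le> K * (M + H) * w (dist x y)"
proof -
  define p :: 'a where "p = undefined"
  define E where "E = exp (b * w D)"
  define N where "N = E * L (\<lambda>_. 1) p"
  have E1: "1 \<le> E" using b w_nonneg D by (simp add: E_def)
  have E_bound: "exp (b * w (dist x y)) \<le> E" for x y :: 'a
    unfolding E_def exp_le_cancel_iff using b w_mono[OF zero_le_dist dist_le] by (intro mult_left_mono)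
  have L1_nonneg: "0 \<le> L (\<lambda>_. 1) x" for x using iterate_nonneg[of "\<lambda>_. 1" 1 x] by simp
  have N: "L (\<lambda>_. 1) x \<le> N" for x
    using iterate_one_bound[of 1 x p] mult_right_mono[OF E_bound[of x p] L1_nonneg[of p]]
    by (simp add: N_def)
  have N0: "0 \<le> N" using L1_nonneg N order_trans by blast
  have upper: "\<bar>L f x\<bar> \<le> N * M" if "\<And>x. \<bar>f x\<bar> \<le> M" for f M x
  proof -
    have M: "0 \<le> M" using that[of p] by simp
    have "\<bar>L f x\<bar> \<le> L (\<lambda>x. \<bar>f x\<bar>) x" by (rule L_abs_le)
    also have "\<dots> \<le> L (\<lambda>_. M * 1) x" using that by (intro L_mono) simp
    also have "\<dots> = M * L (\<lambda>_. 1) x" by (simp only: L_scale)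
    also have "\<dots> \<le> M * N" using N M by (intro mult_left_mono)
    finally show ?thesis by (simp add: mult.commute)
  qed
  define K where "K = N * (E * b + 1)"
  have K0: "0 \<le> K" using N0 E1 b by (simp add: K_def)
  have pos: "L f x - L f y \<le> K * (M + H) * w (dist x y)"
    if f: "0 \<le> H" "\<And>x. \<bar>f x\<bar> \<le> M" "\<And>x y. \<bar>f x - f y\<bar> \<le> H * w (dist x y)" for f M H x y
  proof -
    define d where "d = dist x y"
    have M: "0 \<le> M" using f(2)[of p] by simp
    have d: "0 \<le> d" "d \<le> D" "0 \<le> w d" using w_nonneg dist_le by (auto simp: d_def)
    obtain \<sigma> where \<sigma>: "bij_betw \<sigma> (T -` {x}) (T -` {y})"
      "\<And>z. z \<in> T -` {x} \<Longrightarrow> dist z (\<sigma> z) \<le> d / \<Lambda>" using pairing d_def by blast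
    have "L f y = (\<Sum>z\<in>T -` {x}. exp (A (\<sigma> z)) * f (\<sigma> z))"
      unfolding transfer_operator_def by (rule sum.reindex_bij_betw[OF \<sigma>(1), symmetric])
    then have "L f x - L f y = (\<Sum>z\<in>T -` {x}. exp (A z) * f z - exp (A (\<sigma> z)) * f (\<sigma> z))"
      by (simp add: transfer_operator_def sum_subtractf)
    also have "\<dots> \<le> (\<Sum>z\<in>T -` {x}. ((E * b * M + H) * w d) * (exp (A z) * 1))"
    proof (rule sum_mono)
      fix z assume z: "z \<in> T -` {x}"
      have dz: "dist z (\<sigma> z) \<le> d / \<Lambda>" using \<sigma>(2)[OF z] .
      have "d / \<Lambda> \<le> d" using le_shrink[of d 1] d by simp
      then have wd: "w (dist z (\<sigma> z)) \<le> w d" using dz by (intro w_mono) auto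
      \<comment> \<open>The case of a single term in \<open>sum_le\<close> converts the modulus of
        the potential into that of the space.\<close>
      have "\<bar>A z - A (\<sigma> z)\<bar> \<le> b * w d"
        using A_regular[of z "\<sigma> z"] mult_left_mono[OF \<omega>_mono[OF zero_le_dist dz] a]
          sum_le[of d 1] d by simp
      then have "exp (A (\<sigma> z) - A z) \<le> exp (b * w d)" "exp (A z - A (\<sigma> z)) \<le> exp (b * w d)" by auto
      then have r: "\<bar>1 - exp (A (\<sigma> z) - A z)\<bar> \<le> b * w d * E"
      proof -
        have e: "exp (b * w d) - 1 \<le> b * w d * E"
          using exp_diff_le[of "b * w d"] mult_left_mono[OF E_bound[of x y], of "b * w d"] b d
          by (simp add: d_def)
        have "1 - b * w d \<le> exp (- (b * w d))" using exp_ge_add_one_self[of "- (b * w d)"] by simp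
        also have "\<dots> \<le> exp (A (\<sigma> z) - A z)" using \<open>\<bar>A z - A (\<sigma> z)\<bar> \<le> b * w d\<close> by simp
        finally have "1 - exp (A (\<sigma> z) - A z) \<le> b * w d * E"
          using mult_left_mono[OF E1, of "b * w d"] b d by simp
        then show ?thesis using e \<open>exp (A (\<sigma> z) - A z) \<le> exp (b * w d)\<close> by linarith
      qed
      have "f z - exp (A (\<sigma> z) - A z) * f (\<sigma> z) =
          (f z - f (\<sigma> z)) + (1 - exp (A (\<sigma> z) - A z)) * f (\<sigma> z)" by (simp add: algebra_simps)
      also have "\<dots> \<le> \<bar>f z - f (\<sigma> z)\<bar> + \<bar>1 - exp (A (\<sigma> z) - A z)\<bar> * \<bar>f (\<sigma> z)\<bar>"
        by (simp add: add_mono flip: abs_mult)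
      also have "\<dots> \<le> H * w d + (b * w d * E) * M"
        using f(3)[of z "\<sigma> z"] mult_left_mono[OF wd f(1)] r f(2)
        by (intro add_mono mult_mono) auto
      finally have "f z - exp (A (\<sigma> z) - A z) * f (\<sigma> z) \<le> (E * b * M + H) * w d"
        by (simp add: algebra_simps)
      then have "exp (A z) * (f z - exp (A (\<sigma> z) - A z) * f (\<sigma> z)) \<le> exp (A z) * ((E * b * M + H) * w d)"
        by simp
      then show "exp (A z) * f z - exp (A (\<sigma> z)) * f (\<sigma> z) \<le> ((E * b * M + H) * w d) * (exp (A z) * 1)"
        by (simp add: algebra_simps exp_diff)
    qed
    also have "\<dots> = ((E * b * M + H) * w d) * L (\<lambda>_. 1) x"
      by (simp add: transfer_operator_def sum_distrib_left)
    also have "\<dots> \<le> ((E * b * M + H) * w d) * N"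
      using N E1 b M f(1) d by (intro mult_left_mono) auto
    also have "\<dots> = (N * (E * b * M + H)) * w d" by simp
    also have "\<dots> \<le> (K * (M + H)) * w d"
    proof (intro mult_right_mono d)
      have "0 \<le> E * b * H + M" using E1 b M f(1) by simp
      then have "E * b * M + H \<le> (E * b + 1) * (M + H)" by (simp add: algebra_simps)
      then show "N * (E * b * M + H) \<le> K * (M + H)"
        unfolding K_def using N0 by (simp add: mult.assoc mult_left_mono)
    qed
    finally show ?thesis by (simp add: d_def)
  qed
  have bound: "\<bar>L f x\<bar> \<le> K * M" if "\<And>x. \<bar>f x\<bar> \<le> M" for f M x
  proof -
    have "0 \<le> M" using that[of p] by simp
    have "N \<le> K" unfolding K_def using N0 E1 b by (simp add: algebra_simps)
    then have "N * M \<le> K * M" using \<open>0 \<le> M\<close> by (rule mult_right_mono)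
    then show ?thesis using upper[of f M x, OF that] by linarith
  qed
  have reg: "\<bar>L f x - L f y\<bar> \<le> K * (M + H) * w (dist x y)"
    if f: "0 \<le> H" "\<And>x. \<bar>f x\<bar> \<le> M" "\<And>x y. \<bar>f x - f y\<bar> \<le> H * w (dist x y)" for f M H x y
    using pos[OF f, where x = x and y = y] pos[OF f, where x = y and y = x] by (simp add: dist_commute)
  show ?thesis
    by (rule that[OF K0]; intro allI impI) (rule bound reg; blast)+
qed

lemma L_in_holder:
  assumes "f \<in> X" shows "L f \<in> X"
proof -
  obtain H where H: "0 \<le> H" "\<And>x y. \<bar>f x - f y\<bar> \<le> H * w (dist x y)"
    by (rule holder_spaceE[OF assms], rule that)
  obtain M where M: "0 \<le> M" "\<And>x. \<bar>f x\<bar> \<le> M" by (rule holder_bounded[OF assms], rule that)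
  obtain K where "\<forall>f M H x y. 0 \<le> H \<longrightarrow> (\<forall>x. \<bar>f x\<bar> \<le> M) \<longrightarrow>
      (\<forall>x y. \<bar>f x - f y\<bar> \<le> H * w (dist x y)) \<longrightarrow> \<bar>L f x - L f y\<bar> \<le> K * (M + H) * w (dist x y)"
    by (rule L_holder, rule that)
  from this[rule_format, OF H(1) M(2) H(2)] show ?thesis by (rule holder_spaceI)
qed

end

subsection \<open>Decay of oscillations for the normalized operator\<close>

text \<open>Kept separate from the construction of \<open>h\<close> so that it can be instantiated
  twice: with the constructed eigenfunction for existence, and with that of an arbitrary triple for
  the decay.\<close>

locale eigenfunction = expanding_transfer +
  fixes h :: "'a \<Rightarrow> real" and \<rho> :: real
  assumes h_holder: "h \<in> X" and h_pos: "0 < h x" and \<rho>: "0 < \<rho>" and L_h: "L h x = \<rho> * h x"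
begin

text \<open>Conjugation by \<open>h\<close> and division by the eigenvalue yield Markov operators:
  positive and fixing constants, hence subject to a maximum principle.\<close>

definition P :: "nat \<Rightarrow> ('a \<Rightarrow> real) \<Rightarrow> 'a \<Rightarrow> real" where
  "P n f x = (L ^^ n) (\<lambda>y. h y * f y) x / (\<rho> ^ n * h x)"

lemma iterate_h: "(L ^^ n) h = (\<lambda>x. \<rho> ^ n * h x)"
proof (induction n)
  case (Suc n)
  then show ?case by (auto simp: L_scale L_h)
qed simp

lemma scale_pos: "0 < \<rho> ^ n * h x"
  using \<rho> h_pos by simp

lemma P_zero: "P 0 f = f"
  using h_pos by (auto simp: P_def less_imp_neq[symmetric])

lemma P_const: "P n (\<lambda>_. k) x = k"
proof -
  have "(\<lambda>y. h y * k) = (\<lambda>y. k * h y)" by (simp add: mult.commute)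
  then show ?thesis using \<rho> h_pos[of x] by (simp add: P_def iterate_scale iterate_h)
qed

lemma P_add: "P n (\<lambda>x. f x + g x) = (\<lambda>x. P n f x + P n g x)"
  by (rule ext) (simp add: P_def distrib_left iterate_add add_divide_distrib)

lemma P_scale: "P n (\<lambda>x. k * f x) = (\<lambda>x. k * P n f x)"
  using iterate_scale[of n k "\<lambda>y. h y * f y"] by (intro ext) (simp add: P_def mult_ac)

lemma P_diff: "P n (\<lambda>x. f x - g x) = (\<lambda>x. P n f x - P n g x)"
  using P_add[of n f "\<lambda>x. (-1) * g x"] unfolding P_scale by simp

lemma P_mono: "(\<And>x. f x \<le> g x) \<Longrightarrow> P n f x \<le> P n g x"
  unfolding P_def using scale_pos[of n x] h_pos
  by (intro divide_right_mono iterate_mono) (auto simp: less_imp_le)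

lemma P_nonneg: "(\<And>x. 0 \<le> f x) \<Longrightarrow> 0 \<le> P n f x"
  using P_mono[of "\<lambda>_. 0" f n x] by (simp add: P_const)

lemma P_bounds:
  assumes "\<And>x. l \<le> f x" "\<And>x. f x \<le> u" shows "l \<le> P n f x" "P n f x \<le> u"
  using P_mono[of "\<lambda>_. l" f n x] P_mono[of f "\<lambda>_. u" n x] assms by (simp_all add: P_const)

lemma P_comp: "P (m + n) f = P m (P n f)"
proof
  fix x
  have "(\<lambda>y. h y * P n f y) = (\<lambda>y. (1 / \<rho> ^ n) * (L ^^ n) (\<lambda>y. h y * f y) y)"
    using h_pos by (auto simp: P_def less_imp_neq[symmetric])
  then have "(L ^^ m) (\<lambda>y. h y * P n f y) = (\<lambda>x. (1 / \<rho> ^ n) * (L ^^ (m + n)) (\<lambda>y. h y * f y) x)"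
    by (simp only: iterate_scale funpow_add o_def)
  then show "P (m + n) f x = P m (P n f) x"
    by (simp add: P_def power_add mult_ac)
qed

text \<open>Dividing the additive regularity by the minimum of \<open>h\<close>, which is positive
  by compactness, and using \<open>1 + t \<le> exp t\<close> gives a multiplicative form that can be
  combined with distortion.\<close>

lemma h_ratio:
  obtains e where "0 \<le> e" "\<And>x y. h x \<le> exp (e * w (dist x y)) * h y"
proof -
  obtain H where H: "0 \<le> H" "\<And>x y. \<bar>h x - h y\<bar> \<le> H * w (dist x y)"
    by (rule holder_spaceE[OF h_holder], rule that)
  obtain q where q: "\<And>y. h q \<le> h y"
    using continuous_attains_inf[OF compact _ X.continuous[OF h_holder]] by auto
  have "h x \<le> exp (H / h q * w (dist x y)) * h y" for x y
  proof -
    have "h x \<le> h y + H * w (dist x y)" using H(2)[of x y] by linarith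
    also have "H * w (dist x y) \<le> H * w (dist x y) * (h y / h q)"
      using mult_left_mono[of 1 "h y / h q" "H * w (dist x y)"] q[of y] h_pos[of q] H(1)
        w_nonneg[of "dist x y"] by simp
    also have "h y + H * w (dist x y) * (h y / h q) = (1 + H / h q * w (dist x y)) * h y"
      by (simp add: algebra_simps)
    also have "\<dots> \<le> exp (H / h q * w (dist x y)) * h y"
      using h_pos[of y] by (intro mult_right_mono exp_ge_add_one_self) auto
    finally show ?thesis by simp
  qed
  moreover have "0 \<le> H / h q" using H(1) h_pos[of q] by simp
  ultimately show ?thesis by (intro that)
qed

text \<open>A Harnack-type inequality: \<open>\<delta>\<close> measures the variation of
  \<open>f\<close> at the contracted scale, and distortion acts only as a factor. The radius is left
  free: \<open>r = dist x y\<close> will give regularity and \<open>r = D\<close> the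
  contraction.\<close>

lemma P_compare:
  obtains e where "0 \<le> e"
    "\<forall>n r f \<delta> x y. 0 \<le> r \<longrightarrow> r \<le> D \<longrightarrow> (\<forall>x. 0 \<le> f x) \<longrightarrow> 0 \<le> \<delta> \<longrightarrow>
      (\<forall>x y. dist x y \<le> r / \<Lambda> ^ n \<longrightarrow> f x \<le> f y + \<delta>) \<longrightarrow> dist x y \<le> r \<longrightarrow>
      P n f x \<le> exp (e * w r) * (P n f y + \<delta>)"
proof -
  obtain k where k: "0 \<le> k" "\<And>x y. h x \<le> exp (k * w (dist x y)) * h y"
    by (rule h_ratio, rule that)
  have kr: "h x \<le> exp (k * w r) * h y" if "dist x y \<le> r" for x y :: 'a and r
  proof -
    have "h x \<le> exp (k * w (dist x y)) * h y" by (rule k(2))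
    also have "\<dots> \<le> exp (k * w r) * h y"
      using k(1) h_pos[of y] w_mono[OF zero_le_dist that] by (intro mult_right_mono) (auto simp: mult_left_mono)
    finally show ?thesis .
  qed
  have main: "P n f x \<le> exp ((b + 2 * k) * w r) * (P n f y + \<delta>)"
    if r: "0 \<le> r" "r \<le> D" and f: "\<And>x. 0 \<le> f x" and \<delta>: "0 \<le> \<delta>"
      and step: "\<And>x y. dist x y \<le> r / \<Lambda> ^ n \<Longrightarrow> f x \<le> f y + \<delta>" and d: "dist x y \<le> r"
    for n r f \<delta> x y
  proof -
    define s where "s = r / \<Lambda> ^ n"
    have s: "0 \<le> s" "s \<le> r" using r le_shrink[of r n] \<Lambda> by (auto simp: s_def)
    have ws: "w s \<le> w r" using s by (rule w_mono)
    have nn: "0 \<le> P n f y + \<delta>" using P_nonneg[OF f] \<delta> by simp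
    have "(L ^^ n) (\<lambda>y. h y * f y) x \<le> exp (b * w r) * (L ^^ n) (\<lambda>y. exp (k * w s) * (h y * (f y + \<delta>))) y"
    proof (rule iterate_compare_w[OF r _ _ d])
      fix x y :: 'a assume "dist x y \<le> r / \<Lambda> ^ n"
      then have "h x * f x \<le> (exp (k * w s) * h y) * (f y + \<delta>)"
        using kr[of x y s] step[of x y] h_pos[of x] h_pos[of y] f by (intro mult_mono) (auto simp: s_def)
      then show "h x * f x \<le> exp (k * w s) * (h y * (f y + \<delta>))" by (simp add: mult.assoc)
    qed (use f \<delta> h_pos in \<open>auto simp: less_imp_le\<close>)
    also have "(L ^^ n) (\<lambda>y. exp (k * w s) * (h y * (f y + \<delta>))) y
        = exp (k * w s) * (\<rho> ^ n * h y * P n (\<lambda>y. f y + \<delta>) y)"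
      using \<rho> h_pos[of y] by (simp add: iterate_scale P_def)
    also have "P n (\<lambda>y. f y + \<delta>) y = P n f y + \<delta>" by (simp add: P_add P_const)
    finally have "P n f x \<le> exp (b * w r) * (exp (k * w s) * (\<rho> ^ n * h y * (P n f y + \<delta>))) / (\<rho> ^ n * h x)"
      unfolding P_def[of n f x] using scale_pos[of n x] by (intro divide_right_mono) auto
    also have "\<dots> = exp (b * w r) * (exp (k * w s) * (h y / h x * (P n f y + \<delta>)))"
      using \<rho> by simp
    \<comment> \<open>The three factors come from distortion of the iterates, from \<open>h\<close>
      at paired ends of inverse branches, and from the quotient of \<open>h\<close> at the base
      points; hence the constant \<open>b + 2 * k\<close>.\<close>
    also have "\<dots> \<le> exp (b * w r) * (exp (k * w r) * (exp (k * w r) * (P n f y + \<delta>)))"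
    proof (intro mult_left_mono mult_mono mult_right_mono nn)
      show "exp (k * w s) \<le> exp (k * w r)" using k(1) ws by (simp add: mult_left_mono)
      show "h y / h x \<le> exp (k * w r)"
        using kr[of y x r] d h_pos[of x] by (simp add: dist_commute field_simps)
    qed (use nn h_pos in \<open>auto simp: less_imp_le\<close>)
    also have "\<dots> = exp ((b + 2 * k) * w r) * (P n f y + \<delta>)"
    proof -
      have "(b + 2 * k) * w r = b * w r + (k * w r + k * w r)" by (simp add: algebra_simps)
      then show ?thesis by (simp only: exp_add mult.assoc)
    qed
    finally show ?thesis .
  qed
  have "0 \<le> b + 2 * k" using b k(1) by simp
  then show ?thesis by (rule that) (intro allI impI, rule main, blast+)
qed

text \<open>\<open>P_compare\<close> at \<open>r = dist x y\<close> with
  \<open>\<delta> = H * w r\<close>. The multiplicative error acts on a function normalized to size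
  at most \<open>H * w D\<close>, so the constant is independent of \<open>n\<close>.\<close>

lemma P_holder:
  obtains K where "0 \<le> K"
    "\<forall>n f H x y. 0 \<le> H \<longrightarrow> (\<forall>x y. \<bar>f x - f y\<bar> \<le> H * w (dist x y)) \<longrightarrow>
      \<bar>P n f x - P n f y\<bar> \<le> K * H * w (dist x y)"
proof -
  obtain e where e: "0 \<le> e"
    "\<forall>n r f \<delta> x y. 0 \<le> r \<longrightarrow> r \<le> D \<longrightarrow> (\<forall>x. 0 \<le> f x) \<longrightarrow> 0 \<le> \<delta> \<longrightarrow>
      (\<forall>x y. dist x y \<le> r / \<Lambda> ^ n \<longrightarrow> f x \<le> f y + \<delta>) \<longrightarrow> dist x y \<le> r \<longrightarrow>
      P n f x \<le> exp (e * w r) * (P n f y + \<delta>)"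
    by (rule P_compare, rule that)
  define E where "E = exp (e * w D)"
  define K where "K = E * (e * w D + 1)"
  have wD: "0 \<le> w D" using w_nonneg D by simp
  have upper: "P n f x - P n f y \<le> K * H * w (dist x y)"
    if f: "0 \<le> H" "\<And>x y. \<bar>f x - f y\<bar> \<le> H * w (dist x y)" for n f H x y
  proof -
    define r where "r = dist x y"
    have r: "0 \<le> r" "r \<le> D" "0 \<le> w r" using dist_le w_nonneg by (auto simp: r_def)
    have osc: "\<bar>f x - f y\<bar> \<le> H * w D" for x y
      using f(2)[of x y] mult_left_mono[OF w_mono[OF zero_le_dist dist_le[of x y]] f(1)] by linarith
    obtain m where m: "\<And>x. 0 \<le> f x - m" "\<And>x. f x - m \<le> H * w D"
      by (rule oscillation_normalize[OF osc], rule that)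
    define g where "g x = f x - m" for x
    have Pg: "P n f z = P n g z + m" for z by (simp add: g_def[abs_def] P_diff P_const)
    have bound: "0 \<le> P n g y" "P n g y \<le> H * w D" using P_bounds[of 0 g "H * w D" n y] m by (auto simp: g_def)
    have "P n g x \<le> exp (e * w r) * (P n g y + H * w r)"
    proof (rule e(2)[rule_format, OF r(1,2)])
      fix x y :: 'a assume "dist x y \<le> r / \<Lambda> ^ n"
      then have "dist x y \<le> r" using le_shrink[OF r(1), of n] by linarith
      then have "H * w (dist x y) \<le> H * w r" using f(1) by (intro mult_left_mono w_mono) auto
      then show "g x \<le> g y + H * w r" using f(2)[of x y] by (simp add: g_def)
    qed (use m f r in \<open>auto simp: g_def r_def\<close>)
    then have "P n g x - P n g y \<le> (exp (e * w r) - 1) * P n g y + exp (e * w r) * (H * w r)"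
      by (simp add: algebra_simps)
    also have "\<dots> \<le> (e * w r * E) * (H * w D) + E * (H * w r)"
    proof (intro add_mono mult_mono mult_right_mono bound)
      have "exp (e * w r) \<le> E" using w_mono[OF r(1,2)] e(1) by (simp add: E_def mult_left_mono)
      then show "exp (e * w r) - 1 \<le> e * w r * E" "exp (e * w r) \<le> E"
        using exp_diff_le[of "e * w r"] mult_left_mono[of "exp (e * w r)" E "e * w r"] e(1) r by auto
    qed (use e(1) f(1) r wD in \<open>auto simp: E_def\<close>)
    also have "\<dots> = K * H * w r" by (simp add: K_def algebra_simps)
    finally show ?thesis by (simp add: Pg r_def)
  qed
  have main: "\<bar>P n f x - P n f y\<bar> \<le> K * H * w (dist x y)"
    if "0 \<le> H" "\<And>x y. \<bar>f x - f y\<bar> \<le> H * w (dist x y)" for n f H x y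
    using upper[OF that, where n = n and x = x and y = y] upper[OF that, where n = n and x = y and y = x] by (simp add: dist_commute)
  have "0 \<le> K" using e(1) wD by (simp add: K_def E_def)
  then show ?thesis by (rule that) (intro allI impI, rule main, blast+)
qed

text \<open>The factor is the hyperbolic tangent of Birkhoff's contraction theorem: comparing both \<open>f - min f\<close>
  and \<open>max f - f\<close> and adding the two estimates gains over the trivial bound.\<close>

lemma P_contraction:
  obtains \<gamma> where "0 \<le> \<gamma>" "\<gamma> < 1"
    "\<forall>n f H W x y. 0 \<le> H \<longrightarrow> (\<forall>x y. \<bar>f x - f y\<bar> \<le> H * w (dist x y)) \<longrightarrow>
      (\<forall>x y. \<bar>f x - f y\<bar> \<le> W) \<longrightarrow> \<bar>P n f x - P n f y\<bar> \<le> \<gamma> * W + 2 * H * w (D / \<Lambda> ^ n)"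
proof -
  obtain e where e: "0 \<le> e"
    "\<forall>n r f \<delta> x y. 0 \<le> r \<longrightarrow> r \<le> D \<longrightarrow> (\<forall>x. 0 \<le> f x) \<longrightarrow> 0 \<le> \<delta> \<longrightarrow>
      (\<forall>x y. dist x y \<le> r / \<Lambda> ^ n \<longrightarrow> f x \<le> f y + \<delta>) \<longrightarrow> dist x y \<le> r \<longrightarrow>
      P n f x \<le> exp (e * w r) * (P n f y + \<delta>)"
    by (rule P_compare, rule that)
  define E where "E = exp (e * w D)"
  define \<gamma> where "\<gamma> = (E - 1) / (E + 1)"
  have E1: "1 \<le> E" using e(1) w_nonneg D by (simp add: E_def)
  have upper: "P n f x - P n f y \<le> \<gamma> * W + 2 * H * w (D / \<Lambda> ^ n)"
    if f: "0 \<le> H" "\<And>x y. \<bar>f x - f y\<bar> \<le> H * w (dist x y)" "\<And>x y. \<bar>f x - f y\<bar> \<le> W" for n f H W x y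
  proof -
    define \<delta> where "\<delta> = H * w (D / \<Lambda> ^ n)"
    have \<delta>: "0 \<le> \<delta>" using f(1) D \<Lambda> by (simp add: \<delta>_def w_nonneg)
    have step: "\<bar>f x - f y\<bar> \<le> \<delta>" if "dist x y \<le> D / \<Lambda> ^ n" for x y :: 'a
      using f(2)[of x y] mult_left_mono[OF w_mono[OF zero_le_dist that] f(1)] by (simp add: \<delta>_def)
    obtain m where m: "\<And>x. 0 \<le> f x - m" "\<And>x. f x - m \<le> W"
      by (rule oscillation_normalize[OF f(3)], rule that)
    define g where "g x = f x - m" for x
    define g' where "g' x = W - g x" for x
    have Pf: "P n f z = P n g z + m" for z by (simp add: g_def[abs_def] P_diff P_const)
    have Pg': "P n g' z = W - P n g z" for z by (simp add: g'_def[abs_def] P_diff P_const)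
    have 1: "P n g x \<le> E * (P n g y + \<delta>)"
      unfolding E_def
    proof (rule e(2)[rule_format])
      show "g x \<le> g y + \<delta>" if "dist x y \<le> D / \<Lambda> ^ n" for x y :: 'a using step[OF that] by (simp add: g_def)
    qed (use D \<delta> m in \<open>auto simp: g_def dist_le\<close>)
    have "P n g' y \<le> E * (P n g' x + \<delta>)"
      unfolding E_def
    proof (rule e(2)[rule_format])
      show "g' x \<le> g' y + \<delta>" if "dist x y \<le> D / \<Lambda> ^ n" for x y :: 'a
        using step[OF that] by (simp add: g_def g'_def)
    qed (use D \<delta> m in \<open>auto simp: g_def g'_def dist_le\<close>)
    then have 2: "W - P n g y \<le> E * (W - P n g x + \<delta>)" by (simp add: Pg')
    have "(E + 1) * (P n g x - P n g y) \<le> (E - 1) * W + 2 * (E * \<delta>)"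
      using 1 2 by (simp add: algebra_simps)
    also have "\<dots> \<le> (E - 1) * W + 2 * ((E + 1) * \<delta>)"
      using \<delta> by (simp add: algebra_simps)
    finally have "P n g x - P n g y \<le> \<gamma> * W + 2 * \<delta>"
      unfolding \<gamma>_def using E1 by (simp add: field_simps)
    then show ?thesis by (simp add: Pf \<delta>_def)
  qed
  have main: "\<bar>P n f x - P n f y\<bar> \<le> \<gamma> * W + 2 * H * w (D / \<Lambda> ^ n)"
    if "0 \<le> H" "\<And>x y. \<bar>f x - f y\<bar> \<le> H * w (dist x y)" "\<And>x y. \<bar>f x - f y\<bar> \<le> W" for n f H W x y
    using upper[OF that, where n = n and x = x and y = y] upper[OF that, where n = n and x = y and y = x] by simp
  have "0 \<le> \<gamma>" "\<gamma> < 1" using E1 by (auto simp: \<gamma>_def divide_simps)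
  then show ?thesis by (rule that) (intro allI impI, rule main, blast+)
qed

text \<open>With \<open>N / q\<close> steps for smoothing and the remaining ones handled by induction, the contraction
  factor \<open>\<gamma>\<close> absorbs the loss \<open>(1 - 1 / q) powr -\<alpha>\<close> as soon as \<open>q\<close> is large, so no power of \<open>N\<close> is lost.\<close>

theorem P_decay:
  obtains B where "0 \<le> B"
    "\<forall>f H n x y. 0 \<le> H \<longrightarrow> (\<forall>x y. \<bar>f x - f y\<bar> \<le> H * w (dist x y)) \<longrightarrow> 1 \<le> n \<longrightarrow>
      \<bar>P n f x - P n f y\<bar> \<le> B * H * real n powr (-\<alpha>)"
proof -
  obtain K where K: "0 \<le> K"
    "\<forall>n f H x y. 0 \<le> H \<longrightarrow> (\<forall>x y. \<bar>f x - f y\<bar> \<le> H * w (dist x y)) \<longrightarrow>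
      \<bar>P n f x - P n f y\<bar> \<le> K * H * w (dist x y)"
    by (rule P_holder, rule that)
  obtain \<gamma> where \<gamma>: "0 \<le> \<gamma>" "\<gamma> < 1"
    "\<forall>n f H W x y. 0 \<le> H \<longrightarrow> (\<forall>x y. \<bar>f x - f y\<bar> \<le> H * w (dist x y)) \<longrightarrow>
      (\<forall>x y. \<bar>f x - f y\<bar> \<le> W) \<longrightarrow> \<bar>P n f x - P n f y\<bar> \<le> \<gamma> * W + 2 * H * w (D / \<Lambda> ^ n)"
    by (rule P_contraction, rule that)
  have "(\<lambda>q. \<gamma> * (1 - 1 / real q) powr (-\<alpha>)) \<longlonglongrightarrow> \<gamma> * (1 - 0) powr (-\<alpha>)"
    by (intro tendsto_intros lim_1_over_n) auto
  then have "\<forall>\<^sub>F q in sequentially. \<gamma> * (1 - 1 / real q) powr (-\<alpha>) < 1"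
    using \<gamma>(2) by (intro order_tendstoD) auto
  then obtain q where q: "\<gamma> * (1 - 1 / real q) powr (-\<alpha>) < 1" "2 \<le> q"
    using eventually_happens'[OF sequentially_bot eventually_conj[OF _ eventually_ge_at_top[of 2]]] by blast
  define \<gamma>' where "\<gamma>' = \<gamma> * (1 - 1 / real q) powr (-\<alpha>)"
  \<comment> \<open>The cost of smoothing: \<open>K\<close> bounds the seminorm after any number of
    steps, and \<open>2 * q\<close> enters through the lower bound \<open>n / (2 * q)\<close> for
    the number of smoothing steps.\<close>
  define J where "J = 2 * K * \<kappa> * (2 * real q) powr \<alpha>"
  \<comment> \<open>The first entry settles all \<open>n < q\<close> by the trivial oscillation
    bound; the second is chosen so that the induction closes,
    \<open>\<gamma>' * B + J \<le> B\<close>.\<close>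
  define B where "B = max (w D * real q powr \<alpha>) (J / (1 - \<gamma>'))"
  have \<gamma>': "0 \<le> \<gamma>'" "\<gamma>' < 1" using q \<gamma> by (auto simp: \<gamma>'_def)
  have J: "0 \<le> J" using K \<kappa> by (simp add: J_def)
  have B: "0 \<le> B" "w D * real q powr \<alpha> \<le> B" using w_nonneg[of D] D by (auto simp: B_def le_max_iff_disj)
  have "J / (1 - \<gamma>') \<le> B" by (simp add: B_def)
  then have JB: "\<gamma>' * B + J \<le> B" using \<gamma>' by (simp add: field_simps)
  have main: "\<bar>P n f x - P n f y\<bar> \<le> B * H * real n powr (-\<alpha>)"
    if f: "0 \<le> H" "\<And>x y. \<bar>f x - f y\<bar> \<le> H * w (dist x y)" and n: "1 \<le> n" for f H n x y
    using n
  proof (induction n arbitrary: x y rule: less_induct)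
    case (less n)
    show ?case
    proof (cases "n < q")
      case True
      have osc: "\<bar>f x - f y\<bar> \<le> H * w D" for x y
        using f(2)[of x y] mult_left_mono[OF w_mono[OF zero_le_dist dist_le[of x y]] f(1)] by linarith
      obtain m where m: "\<And>x. 0 \<le> f x - m" "\<And>x. f x - m \<le> H * w D"
        by (rule oscillation_normalize[OF osc], rule that)
      have "m \<le> P n f z \<and> P n f z \<le> m + H * w D" for z
        using P_bounds[of m f "m + H * w D" n z] m by (simp add: algebra_simps)
      from this[of x] this[of y] have "\<bar>P n f x - P n f y\<bar> \<le> H * w D" by linarith
      also have "\<dots> = H * (w D * real q powr \<alpha>) * real q powr (-\<alpha>)"
        using q(2) by (simp add: powr_minus)
      also have "\<dots> \<le> H * B * real n powr (-\<alpha>)"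
        using True B f(1) less.prems \<alpha> w_nonneg[of D] D by (intro mult_mono powr_mono2') auto
      finally show ?thesis by (simp add: mult_ac)
    next
      case False
      define s where "s = n div q"
      define m where "m = n - s"
      have s1: "1 \<le> s" using False q(2) by (simp add: s_def Suc_le_eq div_greater_zero_iff)
      have sn: "s < n" using q(2) less.prems by (simp add: s_def)
      have mn: "m < n" "1 \<le> m" "n = s + m" using s1 sn by (auto simp: m_def)
      have "real n < real s * real q + real q"
        unfolding s_def using dividend_less_div_times[of q n] q(2) by (simp flip: of_nat_mult of_nat_add)
      also have "\<dots> \<le> real s * (2 * real q)" using s1 mult_right_mono[of 1 "real s" "real q"] by (simp add: algebra_simps)
      finally have s_ge: "real n / (2 * real q) \<le> real s" using q(2) by (simp add: field_simps)
      have "real s \<le> real n / real q" unfolding s_def by (rule of_nat_div_le_of_nat)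
      moreover have "real n = real s + real m" using mn(3) by simp
      moreover have "(1 - 1 / real q) * real n = real n - real n / real q"
        by (simp add: left_diff_distrib)
      ultimately have m_ge: "(1 - 1 / real q) * real n \<le> real m" by linarith
      \<comment> \<open>The oscillation of \<open>P m f\<close> is controlled by the induction
        hypothesis, its seminorm by \<open>K * H\<close> uniformly in \<open>m\<close>.\<close>
      have "\<bar>P s (P m f) x - P s (P m f) y\<bar>
          \<le> \<gamma> * (B * H * real m powr (-\<alpha>)) + 2 * (K * H) * w (D / \<Lambda> ^ s)"
        using K f less.IH[OF mn(1,2)] by (intro \<gamma>(3)[rule_format]) auto
      also have "\<dots> \<le> \<gamma> * (B * H * ((1 - 1 / real q) powr (-\<alpha>) * real n powr (-\<alpha>))) +
          2 * (K * H) * (\<kappa> * ((2 * real q) powr \<alpha> * real n powr (-\<alpha>)))"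
      proof (intro add_mono mult_left_mono)
        have "0 < (1 - 1 / real q) * real n" using q(2) less.prems by (simp add: divide_simps)
        then have "real m powr (-\<alpha>) \<le> ((1 - 1 / real q) * real n) powr (-\<alpha>)"
          using m_ge \<alpha> by (intro powr_mono2') auto
        then show "real m powr (-\<alpha>) \<le> (1 - 1 / real q) powr (-\<alpha>) * real n powr (-\<alpha>)"
          using q(2) by (simp add: powr_mult)
        have "w (D / \<Lambda> ^ s) \<le> \<kappa> * real s powr (-\<alpha>)" by (rule w_decay[OF s1])
        also have "\<dots> \<le> \<kappa> * (real n / (2 * real q)) powr (-\<alpha>)"
          using s_ge \<alpha> \<kappa> q(2) less.prems by (intro mult_left_mono powr_mono2') auto
        also have "(real n / (2 * real q)) powr (-\<alpha>) = (2 * real q) powr \<alpha> * real n powr (-\<alpha>)"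
          using q(2) less.prems by (simp add: powr_divide powr_minus field_simps)
        finally show "w (D / \<Lambda> ^ s) \<le> \<kappa> * ((2 * real q) powr \<alpha> * real n powr (-\<alpha>))" .
      qed (use \<gamma> K f B in auto)
      also have "\<dots> = (\<gamma>' * B + J) * (H * real n powr (-\<alpha>))"
        by (simp add: \<gamma>'_def J_def algebra_simps)
      also have "\<dots> \<le> B * (H * real n powr (-\<alpha>))"
        using JB f(1) by (intro mult_right_mono) auto
      finally show ?thesis unfolding mn(3) P_comp by (simp add: mult_ac)
    qed
  qed
  show ?thesis by (rule that[OF B(1)]) (intro allI impI, rule main, blast+)
qed

end

subsection \<open>Existence of the eigenfunction and of the conformal measure\<close>

context expanding_transfer
begin

text \<open>The upper limit \<open>u\<close> of \<open>\<rho> ^ (-n) * L ^ n 1\<close> satisfies \<open>L u \<ge> \<rho> * u\<close>, so \<open>\<rho> ^ (-n) * L ^ n u\<close>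
  increases to an eigenfunction; since the preimage sets are finite, no compactness of a function space is needed.\<close>

theorem eigenfunction_exists:
  obtains h \<rho> where "h \<in> X" "\<And>x. 0 < h x" "0 < \<rho>" "\<And>x. L h x = \<rho> * h x"
proof -
  define p :: 'a where "p = undefined"
  define e where "e = b * w D"
  define s where "s n = (L ^^ n) (\<lambda>_. 1)" for n
  have wD: "b * w (dist x y) \<le> e" for x y :: 'a
    unfolding e_def using b w_mono[OF zero_le_dist dist_le[of x y]] by (rule mult_left_mono[rotated])
  have e0: "0 \<le> e" unfolding e_def using b w_nonneg[of D] D by simp
  have s_pos: "0 < s n x" for n x unfolding s_def by (rule iterate_pos) simp
  have s_ratio: "s n x \<le> exp (b * w (dist x y)) * s n y" for n x y
    unfolding s_def by (rule iterate_one_bound)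
  have s_le: "s n x \<le> exp e * s n y" for n x y
  proof -
    have "exp (b * w (dist x y)) * s n y \<le> exp e * s n y"
      using wD[of x y] s_pos[of n y] by (intro mult_right_mono) auto
    then show ?thesis using s_ratio[of n x y] by linarith
  qed
  have s_Suc: "L (s n) = s (Suc n)" for n by (simp add: s_def)
  \<comment> \<open>Since \<open>s n\<close> varies over the space by at most the factor
    \<open>exp e\<close>, it can be replaced by its value at \<open>p\<close> inside
    \<open>L ^^ m\<close>.\<close>
  have s_add: "s (m + n) p \<le> exp e * (s m p * s n p)" "s m p * s n p \<le> exp e * s (m + n) p" for m n
  proof -
    have s_eq: "s (m + n) = (L ^^ m) (s n)" by (simp add: s_def funpow_add)
    have "(L ^^ m) (s n) p \<le> (L ^^ m) (\<lambda>_. exp e * s n p * 1) p" by (rule iterate_mono) (simp add: s_le)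
    also have "\<dots> = exp e * s n p * s m p" by (simp only: iterate_scale s_def)
    finally show "s (m + n) p \<le> exp e * (s m p * s n p)" by (simp add: s_eq mult_ac)
    have "s m p * s n p = (L ^^ m) (\<lambda>_. s n p * 1) p"
      using iterate_scale[of m "s n p" "\<lambda>_. 1"] by (simp add: s_def[of m] mult.commute)
    also have "\<dots> \<le> (L ^^ m) (\<lambda>x. exp e * s n x) p" by (rule iterate_mono) (simp add: s_le)
    also have "\<dots> = exp e * s (m + n) p" by (simp add: iterate_scale s_eq)
    finally show "s m p * s n p \<le> exp e * s (m + n) p" .
  qed
  have quasi: "\<bar>ln (s (m + n) p) - ln (s m p) - ln (s n p)\<bar> \<le> e" for m n
  proof -
    have "ln (s (m + n) p) \<le> ln (exp e * (s m p * s n p))"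
      using s_add(1)[of m n] s_pos by (subst ln_le_cancel_iff) auto
    moreover have "ln (s m p * s n p) \<le> ln (exp e * s (m + n) p)"
      using s_add(2)[of m n] s_pos by (subst ln_le_cancel_iff) auto
    moreover have "ln (exp e * (s m p * s n p)) = e + ln (s m p) + ln (s n p)"
      "ln (s m p * s n p) = ln (s m p) + ln (s n p)" "ln (exp e * s (m + n) p) = e + ln (s (m + n) p)"
      using s_pos[of m p] s_pos[of n p] s_pos[of "m + n" p] by (simp_all add: ln_mult less_imp_neq[symmetric])
    ultimately show ?thesis by linarith
  qed
  obtain \<theta> where \<theta>: "\<And>n. \<bar>ln (s n p) - real n * \<theta>\<bar> \<le> e"
    by (rule quasi_additive_linear[OF quasi], rule that)
  define \<rho> where "\<rho> = exp \<theta>"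
  have \<rho>: "0 < \<rho>" by (simp add: \<rho>_def)
  define f where "f n x = s n x / \<rho> ^ n" for n x
  have f_p: "exp (- e) \<le> f n p" "f n p \<le> exp e" for n
  proof -
    have "f n p = exp (ln (s n p) - real n * \<theta>)"
      using s_pos[of n p] by (simp add: f_def \<rho>_def exp_diff exp_of_nat_mult)
    then show "exp (- e) \<le> f n p" "f n p \<le> exp e" using \<theta>[of n] by (auto simp: abs_le_iff)
  qed
  have f_ratio: "f n x \<le> exp (b * w (dist x y)) * f n y" for n x y
    using divide_right_mono[OF s_ratio[of n x y], of "\<rho> ^ n"] \<rho> by (simp add: f_def)
  have f_le: "f n x \<le> exp e * f n y" for n x y
    using divide_right_mono[OF s_le[of n x y], of "\<rho> ^ n"] \<rho> by (simp add: f_def)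
  have f_lower: "exp (- e) * exp (- e) \<le> f n x" for n x
  proof -
    have "exp (- e) \<le> exp e * f n x" using f_p(1)[of n] f_le[of n p x] by linarith
    then have "exp (- e) * exp (- e) \<le> exp (- e) * (exp e * f n x)" by (rule mult_left_mono) simp
    also have "\<dots> = f n x" by (simp flip: mult.assoc exp_add)
    finally show ?thesis .
  qed
  have f_upper: "f n x \<le> exp e * exp e" for n x
    by (rule order_trans[OF f_le[of n x p] mult_left_mono[OF f_p(2)]]) simp
  have f_Suc: "L (f n) x = \<rho> * f (Suc n) x" for n x
    using L_scale[of "1 / \<rho> ^ n" "s n"] \<rho> by (simp add: f_def[abs_def] s_Suc field_simps)
  \<comment> \<open>The upper limit written as the infimum of eventual upper bounds, which keeps it
    real-valued.\<close>
  define u where "u x = Inf {k. \<forall>\<^sub>F n in sequentially. f n x \<le> k}" for x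
  have u_set_lower: "exp (- e) * exp (- e) \<le> k" if ev: "\<forall>\<^sub>F n in sequentially. f n x \<le> k" for k x
  proof -
    obtain n where "f n x \<le> k" using eventually_happens'[OF sequentially_bot ev] by blast
    then show ?thesis using f_lower[of n x] by linarith
  qed
  have u_set_upper: "\<forall>\<^sub>F n in sequentially. f n x \<le> exp e * exp e" for x
    using f_upper by simp
  have u_le: "u x \<le> k" if "\<forall>\<^sub>F n in sequentially. f n x \<le> k" for x k
    unfolding u_def using that u_set_lower by (intro cInf_lower bdd_belowI) auto
  have u_ge: "exp (- e) * exp (- e) \<le> u x" for x
    unfolding u_def using u_set_lower u_set_upper by (intro cInf_greatest) auto
  have u_less: "\<forall>\<^sub>F n in sequentially. f n x \<le> k" if less: "u x < k" for x k
  proof -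
    have ne: "{k. \<forall>\<^sub>F n in sequentially. f n x \<le> k} \<noteq> {}" using u_set_upper[of x] by blast
    obtain k' where k': "\<forall>\<^sub>F n in sequentially. f n x \<le> k'" "k' < k"
      using cInf_lessD[OF ne less[unfolded u_def]] by auto
    show ?thesis by (rule eventually_mono[OF k'(1)]) (use k'(2) in linarith)
  qed
  have u_pos: "0 < u x" for x
    by (rule less_le_trans[OF _ u_ge]) simp
  have u_upper: "u x \<le> exp e * exp e" for x by (rule u_le[OF u_set_upper])
  have u_ratio: "u x \<le> exp (b * w (dist x y)) * u y" for x y
  proof -
    have "u x / exp (b * w (dist x y)) \<le> u y"
    proof (rule dense_ge)
      fix k assume "u y < k"
      then have "\<forall>\<^sub>F n in sequentially. f n y \<le> k" by (rule u_less)
      then have "\<forall>\<^sub>F n in sequentially. f n x \<le> exp (b * w (dist x y)) * k"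
      proof (rule eventually_mono)
        fix n assume "f n y \<le> k"
        then have "exp (b * w (dist x y)) * f n y \<le> exp (b * w (dist x y)) * k" by simp
        then show "f n x \<le> exp (b * w (dist x y)) * k" using f_ratio[of n x y] by linarith
      qed
      from u_le[OF this] show "u x / exp (b * w (dist x y)) \<le> k" by (simp add: field_simps)
    qed
    then show ?thesis by (simp add: field_simps)
  qed
  have u_sub: "\<rho> * u x \<le> L u x" for x
  proof (rule field_le_epsilon)
    fix \<epsilon> :: real assume \<epsilon>: "0 < \<epsilon>"
    \<comment> \<open>Applying \<open>L\<close> to the constant \<open>\<delta>\<close> gives
      \<open>\<delta> * s 1 x\<close> at \<open>x\<close>, which is \<open>\<epsilon>\<close> with
      this choice.\<close>
    define \<delta> where "\<delta> = \<epsilon> / s 1 x"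
    have \<delta>: "0 < \<delta>" using \<epsilon> s_pos by (simp add: \<delta>_def)
    have "\<forall>\<^sub>F n in sequentially. \<forall>y\<in>T -` {x}. f n y \<le> u y + \<delta>"
      using \<delta> by (intro eventually_ball_finite finite_preimage ballI u_less) simp
    then have "\<forall>\<^sub>F n in sequentially. f (Suc n) x \<le> (L u x + \<epsilon>) / \<rho>"
    proof (rule eventually_mono)
      fix n assume "\<forall>y\<in>T -` {x}. f n y \<le> u y + \<delta>"
      then have "L (f n) x \<le> L (\<lambda>y. u y + \<delta> * 1) x"
        unfolding transfer_operator_def by (intro sum_mono mult_left_mono) auto
      also have "\<dots> = L u x + \<delta> * s 1 x" by (simp only: L_add L_scale) (simp add: s_def)
      also have "\<dots> = L u x + \<epsilon>" using s_pos[of 1 x] by (simp add: \<delta>_def)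
      finally show "f (Suc n) x \<le> (L u x + \<epsilon>) / \<rho>" using \<rho> by (simp add: f_Suc field_simps)
    qed
    then have "\<forall>\<^sub>F n in sequentially. f n x \<le> (L u x + \<epsilon>) / \<rho>"
      by (simp only: eventually_sequentially_Suc[of "\<lambda>n. f n x \<le> (L u x + \<epsilon>) / \<rho>"])
    from u_le[OF this] show "\<rho> * u x \<le> L u x + \<epsilon>" using \<rho> by (simp add: field_simps)
  qed
  define g where "g n x = (L ^^ n) u x / \<rho> ^ n" for n x
  have g_Suc: "L (g n) x = \<rho> * g (Suc n) x" for n x
    using L_scale[of "1 / \<rho> ^ n" "(L ^^ n) u"] \<rho> by (simp add: g_def[abs_def] field_simps)
  have "g n x \<le> g (Suc n) x" for n x
  proof -
    have "\<rho> * (L ^^ n) u x = (L ^^ n) (\<lambda>x. \<rho> * u x) x" by (simp add: iterate_scale)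
    also have "\<dots> \<le> (L ^^ n) (L u) x" by (rule iterate_mono[OF u_sub])
    finally show ?thesis using \<rho> by (simp add: g_def funpow_swap1 field_simps)
  qed
  then have g_inc: "incseq (\<lambda>n. g n x)" for x by (rule incseq_SucI)
  have g_upper: "g n x \<le> exp e ^ 4" for n x
  proof -
    have "(L ^^ n) u x \<le> (L ^^ n) (\<lambda>_. exp e * exp e * 1) x" by (rule iterate_mono) (simp add: u_upper)
    also have "\<dots> = exp e * exp e * s n x" by (simp only: iterate_scale s_def)
    finally have "g n x \<le> exp e * exp e * f n x"
      using \<rho> by (simp add: g_def f_def divide_right_mono)
    also have "\<dots> \<le> exp e * exp e * (exp e * exp e)" by (intro mult_left_mono f_upper) simp
    finally show ?thesis by (simp add: power4_eq_xxxx mult.assoc)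
  qed
  have "\<exists>l. (\<lambda>n. g n x) \<longlonglongrightarrow> l" for x
    by (rule incseq_convergent[OF g_inc[of x]]) (use g_upper[of _ x] in auto)
  then obtain h where h: "\<And>x. (\<lambda>n. g n x) \<longlonglongrightarrow> h x" by metis
  have h_pos: "0 < h x" for x
    using incseq_le[OF g_inc h, of 0 x] u_pos[of x] by (simp add: g_def)
  have h_upper: "h x \<le> exp e ^ 4" for x
    by (rule LIMSEQ_le_const2[OF h]) (use g_upper in auto)
  have L_h: "L h x = \<rho> * h x" for x
  proof (rule LIMSEQ_unique)
    show "(\<lambda>n. L (g n) x) \<longlonglongrightarrow> L h x"
      unfolding transfer_operator_def by (intro tendsto_sum tendsto_mult tendsto_const h)
    show "(\<lambda>n. L (g n) x) \<longlonglongrightarrow> \<rho> * h x"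
      unfolding g_Suc by (intro tendsto_mult tendsto_const LIMSEQ_Suc h)
  qed
  \<comment> \<open>The factor \<open>2\<close> adds the distortion of the iterates to the
    regularity of \<open>u\<close> itself; both survive the pointwise limit.\<close>
  have h_ratio: "h x \<le> exp (2 * (b * w (dist x y))) * h y" for x y
  proof (rule LIMSEQ_le[OF h tendsto_mult[OF tendsto_const h]])
    have "g n x \<le> exp (2 * (b * w (dist x y))) * g n y" for n
    proof -
      define r where "r = dist x y"
      have r: "0 \<le> r" "r \<le> D" by (auto simp: r_def dist_le)
      have "(L ^^ n) u x \<le> exp (b * w r) * (L ^^ n) (\<lambda>z. exp (b * w r) * u z) y"
      proof (rule iterate_compare_w[OF r])
        fix x' y' :: 'a assume "dist x' y' \<le> r / \<Lambda> ^ n"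
        then have "dist x' y' \<le> r" using le_shrink[OF r(1), of n] by linarith
        then have "exp (b * w (dist x' y')) * u y' \<le> exp (b * w r) * u y'"
          using b w_mono[of "dist x' y'" r] u_pos[of y'] by (intro mult_right_mono) (auto intro: mult_left_mono)
        then show "u x' \<le> exp (b * w r) * u y'" using u_ratio[of x' y'] by linarith
      qed (use u_pos in \<open>auto simp: r_def less_imp_le\<close>)
      also have "\<dots> = exp (2 * (b * w r)) * (L ^^ n) u y"
        unfolding iterate_scale mult_2 exp_add by simp
      finally show ?thesis using \<rho> by (simp add: g_def r_def divide_right_mono)
    qed
    then show "\<exists>N. \<forall>n\<ge>N. g n x \<le> exp (2 * (b * w (dist x y))) * g n y" by blast
  qed
  have upper: "h x - h y \<le> (2 * b * exp (2 * e) * exp e ^ 4) * w (dist x y)" for x y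
  proof -
    define t where "t = 2 * (b * w (dist x y))"
    have t: "0 \<le> t" using b w_nonneg[of "dist x y"] by (simp add: t_def)
    have "h x - h y \<le> (exp t - 1) * h y" using h_ratio[of x y] by (simp add: t_def algebra_simps)
    also have "\<dots> \<le> (t * exp (2 * e)) * exp e ^ 4"
    proof (intro mult_mono h_upper)
      have "exp t \<le> exp (2 * e)" using wD[of x y] by (simp add: t_def)
      then have "t * exp t \<le> t * exp (2 * e)" using t by (rule mult_left_mono)
      then show "exp t - 1 \<le> t * exp (2 * e)" using exp_diff_le[OF t] by linarith
    qed (use t h_pos in \<open>auto simp: less_imp_le\<close>)
    finally show ?thesis by (simp add: t_def mult_ac)
  qed
  have "h \<in> X"
  proof (rule holder_spaceI)
    fix x y show "\<bar>h x - h y\<bar> \<le> (2 * b * exp (2 * e) * exp e ^ 4) * w (dist x y)"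
      using upper[of x y] upper[of y x] by (simp add: dist_commute)
  qed
  then show ?thesis using h_pos \<rho> L_h by (rule that)
qed

end

section \<open>Continuity of the map and of the operator\<close>

context expanding_transfer
begin

text \<open>Let \<open>x n\<close> tend to \<open>l\<close> and, along a subsequence,
  \<open>T (x n)\<close> to \<open>z\<close>. Pairing yields points of the fibre over
  \<open>z\<close> whose distance to \<open>x n\<close> tends to \<open>0\<close>; they converge to
  \<open>l\<close>, and the fibre is finite, hence closed, so \<open>T l = z\<close>.\<close>

lemma continuous_T: "continuous_on UNIV T"
proof -
  have "closed (T -` C)" if C: "closed C" for C
    unfolding closed_sequential_limits
  proof (intro allI impI, elim conjE)
    fix x l assume x: "\<forall>n. x n \<in> T -` C" "x \<longlonglongrightarrow> l"
    obtain z r where zr: "strict_mono r" "((\<lambda>n. T (x n)) \<circ> r) \<longlonglongrightarrow> z"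
      using compact unfolding compact_def by (metis UNIV_I)
    have "z \<in> C"
      by (rule closed_sequentially[OF C _ zr(2)]) (use x(1) in auto)
    have "\<forall>n. \<exists>q. q \<in> T -` {z} \<and> dist (x (r n)) q \<le> dist (T (x (r n))) z / \<Lambda>"
    proof
      fix n
      obtain \<sigma> where \<sigma>: "bij_betw \<sigma> (T -` {T (x (r n))}) (T -` {z})"
        "\<forall>q\<in>T -` {T (x (r n))}. dist q (\<sigma> q) \<le> dist (T (x (r n))) z / \<Lambda>" using pairing by blast
      have "x (r n) \<in> T -` {T (x (r n))}" by simp
      with \<sigma> show "\<exists>q. q \<in> T -` {z} \<and> dist (x (r n)) q \<le> dist (T (x (r n))) z / \<Lambda>"
        using bij_betwE by blast
    qed
    then obtain q where q: "\<And>n. q n \<in> T -` {z}" "\<And>n. dist (x (r n)) (q n) \<le> dist (T (x (r n))) z / \<Lambda>"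
      by metis
    have "(\<lambda>n. dist (T (x (r n))) z / \<Lambda>) \<longlonglongrightarrow> 0 / \<Lambda>"
      using zr(2) \<Lambda> tendsto_dist_iff[of "\<lambda>n. T (x (r n))" z]
      by (intro tendsto_divide tendsto_const) (simp_all add: o_def)
    then have "(\<lambda>n. dist (x (r n)) (q n)) \<longlonglongrightarrow> 0"
      using tendsto_sandwich[of "\<lambda>_. 0" "\<lambda>n. dist (x (r n)) (q n)" sequentially
          "\<lambda>n. dist (T (x (r n))) z / \<Lambda>" 0] q(2) by simp
    moreover have "(\<lambda>n. dist (x (r n)) l) \<longlonglongrightarrow> 0"
      using LIMSEQ_subseq_LIMSEQ[OF x(2) zr(1)] tendsto_dist_iff[of "\<lambda>n. x (r n)" l]
      by (simp add: o_def)
    ultimately have "(\<lambda>n. dist (x (r n)) (q n) + dist (x (r n)) l) \<longlonglongrightarrow> 0 + 0" by (rule tendsto_add)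
    moreover have "\<forall>\<^sub>F n in sequentially. dist (q n) l \<le> dist (x (r n)) (q n) + dist (x (r n)) l"
      by (intro always_eventually allI dist_triangle3)
    ultimately have "(\<lambda>n. dist (q n) l) \<longlonglongrightarrow> 0"
      using tendsto_sandwich[of "\<lambda>_. 0" "\<lambda>n. dist (q n) l" sequentially
          "\<lambda>n. dist (x (r n)) (q n) + dist (x (r n)) l" 0] by simp
    then have "q \<longlonglongrightarrow> l" by (rule tendsto_dist_iff[THEN iffD2])
    then have "l \<in> T -` {z}"
      by (rule closed_sequentially[OF finite_imp_closed[OF finite_preimage] q(1)])
    then show "l \<in> T -` C" using \<open>z \<in> C\<close> by simp
  qed
  then show ?thesis by (simp add: continuous_on_closed_vimage)
qed

lemma continuous_T_iterate: "continuous_on UNIV (T ^^ n)"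
proof (induction n)
  case (Suc n)
  show ?case
    unfolding funpow.simps using continuous_on_compose[OF Suc] continuous_on_subset[OF continuous_T] by blast
qed (simp add: id_def)

text \<open>Off the diagonal, division by \<open>w (dist x y) > 0\<close> exhibits a lower bound for
  all admissible constants, so the infimum is itself admissible.\<close>

lemma holder_const_bound:
  assumes "f \<in> X"
  shows "0 \<le> holder_const w f" "\<bar>f x - f y\<bar> \<le> holder_const w f * w (dist x y)"
proof -
  let ?S = "{C. 0 \<le> C \<and> (\<forall>x y. \<bar>f x - f y\<bar> \<le> C * w (dist x y))}"
  obtain H where "0 \<le> H" "\<And>x y. \<bar>f x - f y\<bar> \<le> H * w (dist x y)"
    by (rule holder_spaceE[OF assms], rule that)
  then have "H \<in> ?S" by simp
  then have ne: "?S \<noteq> {}" by (rule ex_in_conv[THEN iffD1, OF exI])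
  show "0 \<le> holder_const w f" unfolding holder_const_def using ne by (intro cInf_greatest) auto
  show "\<bar>f x - f y\<bar> \<le> holder_const w f * w (dist x y)"
  proof (cases "x = y")
    case False
    then have pos: "0 < w (dist x y)" by (intro w_pos) simp
    have "\<bar>f x - f y\<bar> / w (dist x y) \<le> holder_const w f"
      unfolding holder_const_def using ne pos by (intro cInf_greatest) (auto simp: field_simps)
    then show ?thesis using pos by (simp add: field_simps)
  qed (simp add: w_zero)
qed

lemma holder_const_le:
  "0 \<le> H \<Longrightarrow> (\<And>x y. \<bar>f x - f y\<bar> \<le> H * w (dist x y)) \<Longrightarrow> holder_const w f \<le> H"
  unfolding holder_const_def by (intro cInf_lower bdd_belowI[of _ 0]) auto

lemma acts_continuously_L: "acts_continuously X (holder_norm w) L"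
  unfolding acts_continuously_def
proof (intro conjI ballI allI impI)
  fix f assume "f \<in> X" then show "L f \<in> X" by (rule L_in_holder)
next
  fix f :: "'a \<Rightarrow> real" and \<epsilon> :: real assume f: "f \<in> X" and \<epsilon>: "0 < \<epsilon>"
  obtain K where K0: "0 \<le> K" and K: "\<forall>f M x. (\<forall>x. \<bar>f x\<bar> \<le> M) \<longrightarrow> \<bar>L f x\<bar> \<le> K * M"
    "\<forall>f M H x y. 0 \<le> H \<longrightarrow> (\<forall>x. \<bar>f x\<bar> \<le> M) \<longrightarrow> (\<forall>x y. \<bar>f x - f y\<bar> \<le> H * w (dist x y)) \<longrightarrow>
       \<bar>L f x - L f y\<bar> \<le> K * (M + H) * w (dist x y)"
    by (rule L_holder, rule that)
  have norm: "holder_norm w (L u) \<le> 2 * K * holder_norm w u" if u: "u \<in> X" for u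
  proof -
    define M where "M = (SUP x. \<bar>u x\<bar>)"
    define H where "H = holder_const w u"
    obtain B where "0 \<le> B" and B: "\<And>x. \<bar>u x\<bar> \<le> B" by (rule holder_bounded[OF u], rule that)
    have "bdd_above (range (\<lambda>x. \<bar>u x\<bar>))" by (rule bdd_aboveI2[where M = B]) (rule B)
    then have M: "\<bar>u x\<bar> \<le> M" for x unfolding M_def by (intro cSUP_upper) auto
    have M0: "0 \<le> M" using order_trans[OF abs_ge_zero M] .
    have H: "0 \<le> H" "\<And>x y. \<bar>u x - u y\<bar> \<le> H * w (dist x y)"
      unfolding H_def using holder_const_bound[OF u] by auto
    have "(SUP x. \<bar>L u x\<bar>) \<le> K * M"
      using K(1) M by (intro cSUP_least) auto
    moreover have "holder_const w (L u) \<le> K * (M + H)"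
      using K(2) M H K0 M0 by (intro holder_const_le) auto
    ultimately have "holder_norm w (L u) \<le> K * M + K * (M + H)" unfolding holder_norm_def by linarith
    also have "\<dots> \<le> 2 * K * (M + H)" using mult_nonneg_nonneg[OF K0 H(1)] by (simp add: algebra_simps)
    finally show ?thesis by (simp add: holder_norm_def M_def H_def)
  qed
  show "\<exists>\<delta>>0. \<forall>g\<in>X. holder_norm w (\<lambda>x. g x - f x) < \<delta> \<longrightarrow> holder_norm w (\<lambda>x. L g x - L f x) < \<epsilon>"
  \<comment> \<open>The summand \<open>1\<close> covers the possibility that \<open>K\<close> is
    \<open>0\<close> and makes the final inequality strict.\<close>
  proof (intro exI[of _ "\<epsilon> / (2 * K + 1)"] conjI ballI impI)
    show "0 < \<epsilon> / (2 * K + 1)" using \<epsilon> K0 by simp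
    fix g assume g: "g \<in> X" and small: "holder_norm w (\<lambda>x. g x - f x) < \<epsilon> / (2 * K + 1)"
    have "L (\<lambda>x. g x - f x) = (\<lambda>x. L g x - L f x)"
      using L_add[of g "\<lambda>x. (-1) * f x"] unfolding L_scale by simp
    then have "holder_norm w (\<lambda>x. L g x - L f x) \<le> 2 * K * holder_norm w (\<lambda>x. g x - f x)"
      using norm[OF X.diff[OF g f]] by simp
    also have "\<dots> \<le> 2 * K * (\<epsilon> / (2 * K + 1))" using small K0 by (intro mult_left_mono) auto
    also have "\<dots> < \<epsilon>" using \<epsilon> K0 by (simp add: field_simps)
    finally show "holder_norm w (\<lambda>x. L g x - L f x) < \<epsilon>" .
  qed
qed

end

section \<open>The limit functional and the conformal measure\<close>

context eigenfunction
begin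

lemma P_in_holder:
  assumes "f \<in> X" shows "P n f \<in> X"
proof -
  obtain H where H: "0 \<le> H" "\<And>x y. \<bar>f x - f y\<bar> \<le> H * w (dist x y)"
    by (rule holder_spaceE[OF assms], rule that)
  obtain K where K: "0 \<le> K" "\<forall>n f H x y. 0 \<le> H \<longrightarrow> (\<forall>x y. \<bar>f x - f y\<bar> \<le> H * w (dist x y)) \<longrightarrow>
      \<bar>P n f x - P n f y\<bar> \<le> K * H * w (dist x y)"
    by (rule P_holder, rule that)
  show ?thesis by (rule holder_spaceI, rule K(2)[rule_format, OF H])
qed

text \<open>By the maximum principle all later iterates stay between the extreme values of
  \<open>P n f\<close>, whose distance tends to \<open>0\<close>; hence the Cauchy property.\<close>

lemma P_converges:
  assumes "f \<in> X" shows "convergent (\<lambda>n. P n f p)"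
proof -
  obtain H where H: "0 \<le> H" "\<And>x y. \<bar>f x - f y\<bar> \<le> H * w (dist x y)"
    by (rule holder_spaceE[OF assms], rule that)
  obtain B where B: "0 \<le> B" "\<forall>f H n x y. 0 \<le> H \<longrightarrow> (\<forall>x y. \<bar>f x - f y\<bar> \<le> H * w (dist x y)) \<longrightarrow> 1 \<le> n \<longrightarrow>
      \<bar>P n f x - P n f y\<bar> \<le> B * H * real n powr (-\<alpha>)"
    by (rule P_decay, rule that)
  have diff: "\<bar>P m f p - P n f p\<bar> \<le> B * H * real n powr (-\<alpha>)" if "1 \<le> n" "n \<le> m" for m n
  proof -
    have "\<bar>P n f x - P n f p\<bar> \<le> B * H * real n powr (-\<alpha>)" for x
      using B(2)[rule_format, OF H that(1)] .
    then have "P n f p - B * H * real n powr (-\<alpha>) \<le> P n f x"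
      "P n f x \<le> P n f p + B * H * real n powr (-\<alpha>)" for x
      by (auto simp: abs_le_iff algebra_simps)
    from P_bounds[where f = "P n f" and n = "m - n" and x = p, OF this] have
      "\<bar>P (m - n) (P n f) p - P n f p\<bar> \<le> B * H * real n powr (-\<alpha>)" by (simp add: abs_le_iff)
    then show ?thesis using that(2) by (simp flip: P_comp)
  qed
  have "((\<lambda>n. B * H * real n powr (-\<alpha>)) \<longlongrightarrow> B * H * 0) sequentially"
    using \<alpha> by (intro tendsto_mult tendsto_const tendsto_neg_powr filterlim_real_sequentially) auto
  then have lim: "(\<lambda>n. B * H * real n powr (-\<alpha>)) \<longlonglongrightarrow> 0" by simp
  have "Cauchy (\<lambda>n. P n f p)"
    unfolding Cauchy_altdef
  proof (intro allI impI)
    fix \<epsilon> :: real assume "0 < \<epsilon>"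
    then have "\<forall>\<^sub>F n in sequentially. B * H * real n powr (-\<alpha>) < \<epsilon>"
      using order_tendstoD(2)[OF lim] by blast
    then obtain N where N: "\<And>n. N \<le> n \<Longrightarrow> B * H * real n powr (-\<alpha>) < \<epsilon>"
      unfolding eventually_sequentially by blast
    show "\<exists>M. \<forall>m\<ge>M. \<forall>n>m. dist (P m f p) (P n f p) < \<epsilon>"
    proof (intro exI[of _ "max 1 N"] allI impI)
      fix m n assume "max 1 N \<le> m" "m < n"
      then show "dist (P m f p) (P n f p) < \<epsilon>"
        using diff[of m n] N[of m] by (simp add: dist_real_def abs_minus_commute)
    qed
  qed
  then show ?thesis by (rule real_Cauchy_convergent)
qed

lemma h_bounds:
  obtains l u where "0 < l" "\<And>x. l \<le> h x" "\<And>x. h x \<le> u"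
proof -
  obtain q where q: "\<And>y. h q \<le> h y"
    using continuous_attains_inf[OF compact _ X.continuous[OF h_holder]] by auto
  obtain q' where q': "\<And>y. h y \<le> h q'"
    using continuous_attains_sup[OF compact _ X.continuous[OF h_holder]] by auto
  show ?thesis by (rule that[OF h_pos q q'])
qed

lemma inverse_h_holder: "(\<lambda>x. 1 / h x) \<in> X"
proof -
  obtain H where H: "0 \<le> H" "\<And>x y. \<bar>h x - h y\<bar> \<le> H * w (dist x y)"
    by (rule holder_spaceE[OF h_holder], rule that)
  obtain l u where l: "0 < l" "\<And>x. l \<le> h x" "\<And>x. h x \<le> u" by (rule h_bounds, rule that)
  show ?thesis
  proof (rule holder_spaceI)
    fix x y
    have "1 / h x - 1 / h y = (h y - h x) / (h x * h y)"
      using h_pos[of x] h_pos[of y] by (simp add: field_simps)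
    then have "\<bar>1 / h x - 1 / h y\<bar> = \<bar>h x - h y\<bar> / (h x * h y)"
      using h_pos[of x] h_pos[of y] by (simp add: abs_divide abs_mult abs_minus_commute)
    also have "\<dots> \<le> (H * w (dist x y)) / (l * l)"
      using H(2)[of x y] l(1) l(2)[of x] l(2)[of y] by (intro frac_le mult_mono) auto
    finally show "\<bar>1 / h x - 1 / h y\<bar> \<le> (H / (l * l)) * w (dist x y)" by simp
  qed
qed

theorem rpf_triple_exists:
  obtains \<nu> where "rpf_triple X L h \<rho> \<nu>"
proof -
  define p :: 'a where "p = undefined"
  define \<Phi> where "\<Phi> f = lim (\<lambda>n. P n f p)" for f
  have lim: "(\<lambda>n. P n f p) \<longlonglongrightarrow> \<Phi> f" if "f \<in> X" for f
    using P_converges[OF that] by (simp add: \<Phi>_def convergent_LIMSEQ_iff)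
  interpret \<Phi>: positive_functional X \<Phi>
  proof
    fix f g assume fg: "f \<in> X" "g \<in> X"
    show "\<Phi> (\<lambda>x. f x + g x) = \<Phi> f + \<Phi> g"
      using LIMSEQ_unique[OF lim[OF X.add[OF fg]]] tendsto_add[OF lim[OF fg(1)] lim[OF fg(2)]]
      by (simp add: P_add)
  next
    fix f k assume f: "f \<in> X"
    show "\<Phi> (\<lambda>x. k * f x) = k * \<Phi> f"
      using LIMSEQ_unique[OF lim[OF X.scale[OF f]]] tendsto_mult[OF tendsto_const lim[OF f]]
      by (simp add: P_scale)
    show "0 \<le> \<Phi> f" if "\<And>x. 0 \<le> f x"
      by (rule LIMSEQ_le_const[OF lim[OF f]]) (use P_nonneg[OF that] in auto)
  next
    show "\<Phi> (\<lambda>_. 1) = 1" by (simp add: \<Phi>_def P_const)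
  qed
  obtain M where "prob_space M" and sets: "sets M = sets borel"
    and M: "\<And>f. f \<in> X \<Longrightarrow> (\<integral>x. f x \<partial>M) = \<Phi> f"
    by (rule \<Phi>.representing_measure, rule that)
  interpret M: prob_space M by fact
  \<comment> \<open>Applying \<open>P 1\<close> first merely shifts the sequence that defines the
    limit.\<close>
  have \<Phi>_P: "\<Phi> (P 1 f) = \<Phi> f" if "f \<in> X" for f
  proof -
    have "(\<lambda>n. P n (P 1 f) p) = (\<lambda>n. P (Suc n) f p)" by (simp flip: P_comp)
    then show ?thesis
      using LIMSEQ_unique[OF lim[OF P_in_holder[OF that, of 1]]] LIMSEQ_Suc[OF lim[OF that]] by simp
  qed
  define \<nu> where "\<nu> = density M (\<lambda>x. ennreal (1 / h x))"
  have space: "space M = UNIV" using sets_eq_imp_space_eq[OF sets] by simp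
  have meas: "f \<in> borel_measurable M" if "f \<in> X" for f
    using X.borel[OF that] measurable_cong_sets[OF sets refl] by blast
  have inv: "(\<lambda>x. 1 / h x) \<in> borel_measurable M" by (rule meas[OF inverse_h_holder])
  have inv_int: "integrable M (\<lambda>x. 1 / h x)"
    using X.integrable[OF M.finite_measure_axioms sets X.continuous[OF inverse_h_holder]] .
  obtain l u where lu: "0 < l" "\<And>x. l \<le> h x" "\<And>x. h x \<le> u" by (rule h_bounds, rule that)
  have u: "0 < u" using h_pos[of p] lu(3)[of p] by linarith
  have "(\<integral>x. 1 / u \<partial>M) \<le> (\<integral>x. 1 / h x \<partial>M)"
    using lu(3) h_pos inv_int u by (intro integral_mono M.integrable_const divide_left_mono) auto
  then have "1 / u \<le> (\<integral>x. 1 / h x \<partial>M)" using M.prob_space space by simp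
  then have pos: "0 < (\<integral>x. 1 / h x \<partial>M)" using u less_le_trans[of 0 "1 / u"] by simp
  have "emeasure \<nu> (space \<nu>) = (\<integral>\<^sup>+x. ennreal (1 / h x) \<partial>M)"
    using inv by (simp add: \<nu>_def emeasure_density cong: nn_integral_cong)
  also have "\<dots> = ennreal (\<integral>x. 1 / h x \<partial>M)"
    using h_pos by (intro nn_integral_eq_integral inv_int) (auto simp: less_imp_le)
  finally have total: "emeasure \<nu> (space \<nu>) = ennreal (\<integral>x. 1 / h x \<partial>M)" .
  have integral_\<nu>: "(\<integral>x. f x \<partial>\<nu>) = \<Phi> (\<lambda>x. 1 / h x * f x)" if "f \<in> X" for f
  proof -
    have "(\<integral>x. f x \<partial>\<nu>) = (\<integral>x. 1 / h x * f x \<partial>M)"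
      unfolding \<nu>_def using h_pos by (subst integral_density) (auto simp: meas that inv less_imp_le)
    then show ?thesis using M[OF X.mult[OF inverse_h_holder that]] by (rule trans)
  qed
  have "(\<integral>x. L f x \<partial>\<nu>) = \<rho> * (\<integral>x. f x \<partial>\<nu>)" if f: "f \<in> X" for f
  proof -
    \<comment> \<open>Division by \<open>h\<close> turns \<open>L\<close> into \<open>\<rho>\<close>
      times \<open>P 1\<close>, so conformality of \<open>\<nu>\<close> becomes invariance of
      \<open>\<Phi>\<close>.\<close>
    define g where "g x = 1 / h x * f x" for x
    have g: "g \<in> X" unfolding g_def[abs_def] by (intro X.mult inverse_h_holder f)
    have hg: "(\<lambda>y. h y * g y) = f" using h_pos by (auto simp: g_def less_imp_neq[symmetric])
    have "(\<lambda>x. 1 / h x * L f x) = (\<lambda>x. \<rho> * P 1 g x)"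
      unfolding P_def hg using \<rho> by auto
    then have "(\<integral>x. L f x \<partial>\<nu>) = \<Phi> (\<lambda>x. \<rho> * P 1 g x)" by (simp add: integral_\<nu> L_in_holder f)
    also have "\<dots> = \<rho> * \<Phi> g" using \<Phi>_P[OF g] by (simp add: \<Phi>.\<Phi>_scale P_in_holder g)
    also have "\<Phi> g = (\<integral>x. f x \<partial>\<nu>)" unfolding g_def[abs_def] by (rule integral_\<nu>[OF f, symmetric])
    finally show ?thesis .
  qed
  moreover have "finite_measure \<nu>" by (rule finite_measureI) (simp add: total)
  moreover have "sets \<nu> = sets borel" by (simp add: \<nu>_def sets)
  ultimately have "rpf_triple X L h \<rho> \<nu>"
    unfolding rpf_triple_def using h_holder h_pos \<rho> L_h total pos by simp
  then show ?thesis by (rule that)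
qed

end

subsection \<open>Decay of correlations\<close>

context eigenfunction
begin

text \<open>Composition with \<open>T\<close> is here only known to preserve continuity, so the
  identities must be extended beyond \<open>X\<close>. Stone-Weierstrass supplies the approximation,
  and the maximum principle keeps it uniform in \<open>n\<close>.\<close>

lemma P_approximation:
  assumes "continuous_on UNIV f" "0 < \<epsilon>"
  obtains g where "g \<in> X" "\<And>x. \<bar>f x - g x\<bar> < \<epsilon>" "\<And>n x. \<bar>P n f x - P n g x\<bar> \<le> \<epsilon>"
proof -
  obtain g where g: "g \<in> X" "\<And>x. \<bar>f x - g x\<bar> < \<epsilon>"
    using X.Stone_Weierstrass_basic[OF assms] by auto
  have "\<bar>P n f x - P n g x\<bar> \<le> \<epsilon>" for n x
  proof -
    have "- \<epsilon> \<le> f y - g y" "f y - g y \<le> \<epsilon>" for y using g(2)[of y] by linarith+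
    from P_bounds[where f = "\<lambda>x. f x - g x" and n = n and x = x, OF this]
    show ?thesis by (simp add: P_diff abs_le_iff)
  qed
  with g show ?thesis by (rule that)
qed

lemma P_continuous:
  assumes "continuous_on UNIV f" shows "continuous_on UNIV (P n f)"
proof -
  have "\<exists>g. g \<in> X \<and> (\<forall>x. \<bar>P n f x - P n g x\<bar> \<le> 1 / real (Suc k))" for k
  proof -
    have pos: "0 < 1 / real (Suc k)" by simp
    obtain g where "g \<in> X" "\<And>x. \<bar>f x - g x\<bar> < 1 / real (Suc k)"
      "\<And>n x. \<bar>P n f x - P n g x\<bar> \<le> 1 / real (Suc k)"
      by (rule P_approximation[OF assms pos], rule that)
    then show ?thesis by blast
  qed
  then obtain g where g: "\<And>k. g k \<in> X" "\<And>k x. \<bar>P n f x - P n (g k) x\<bar> \<le> 1 / real (Suc k)"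
    by metis
  show ?thesis
  proof (rule uniform_limit_theorem)
    show "\<forall>\<^sub>F k in sequentially. continuous_on UNIV (P n (g k))"
      using X.continuous[OF P_in_holder[OF g(1)]] by simp
    show "uniform_limit UNIV (\<lambda>k. P n (g k)) (P n f) sequentially"
    proof (rule uniform_limitI)
      fix \<epsilon> :: real assume "0 < \<epsilon>"
      then have "\<forall>\<^sub>F k in sequentially. 1 / real (Suc k) < \<epsilon>"
        using order_tendstoD(2)[OF LIMSEQ_Suc[OF lim_1_over_n]] by blast
      then show "\<forall>\<^sub>F k in sequentially. \<forall>x\<in>UNIV. dist (P n (g k) x) (P n f x) < \<epsilon>"
      proof (rule eventually_mono)
        fix k assume k: "1 / real (Suc k) < \<epsilon>"
        show "\<forall>x\<in>UNIV. dist (P n (g k) x) (P n f x) < \<epsilon>"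
        proof
          fix x
          show "dist (P n (g k) x) (P n f x) < \<epsilon>"
            using g(2)[of x k] k by (simp add: dist_real_def abs_minus_commute)
        qed
      qed
    qed
  qed simp
qed

text \<open>\<open>g \<circ> T\<close> is constant on each fibre and leaves the sum; iterating this
  gives the duality.\<close>

lemma P_comp_T: "P 1 (\<lambda>x. f x * g (T x)) = (\<lambda>x. P 1 f x * g x)"
proof
  fix x
  have "L (\<lambda>y. h y * (f y * g (T y))) x = L (\<lambda>y. h y * f y) x * g x"
    unfolding transfer_operator_def sum_distrib_right by (intro sum.cong) auto
  then show "P 1 (\<lambda>x. f x * g (T x)) x = P 1 f x * g x" by (simp add: P_def)
qed

theorem polynomial_decay_density:
  assumes triple: "rpf_triple X L h \<rho> \<nu>" and prob: "prob_space (density \<nu> (\<lambda>x. ennreal (h x)))"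
  shows "polynomial_decay T (density \<nu> (\<lambda>x. ennreal (h x))) w \<alpha>"
proof -
  define \<mu> where "\<mu> = density \<nu> (\<lambda>x. ennreal (h x))"
  interpret \<mu>: prob_space \<mu> using prob by (simp add: \<mu>_def)
  have sets\<nu>: "sets \<nu> = sets borel"
    and conformal: "\<And>f. f \<in> X \<Longrightarrow> (\<integral>x. L f x \<partial>\<nu>) = \<rho> * (\<integral>x. f x \<partial>\<nu>)"
    using triple by (auto simp: rpf_triple_def)
  have sets: "sets \<mu> = sets borel" by (simp add: \<mu>_def sets\<nu>)
  have space: "space \<mu> = UNIV" using sets_eq_imp_space_eq[OF sets] by simp
  have meas\<nu>: "f \<in> borel_measurable \<nu>" if "f \<in> X" for f
    using X.borel[OF that] measurable_cong_sets[OF sets\<nu> refl] by blast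
  have meas: "f \<in> borel_measurable \<mu>" if "continuous_on UNIV f" for f :: "'a \<Rightarrow> real"
    using borel_measurable_continuous_onI[OF that] measurable_cong_sets[OF sets refl] by blast
  have int: "integrable \<mu> f" if "continuous_on UNIV f" for f :: "'a \<Rightarrow> real"
    by (rule X.integrable[OF \<mu>.finite_measure_axioms sets that])
  have inv_X: "(\<integral>x. P 1 f x \<partial>\<mu>) = (\<integral>x. f x \<partial>\<mu>)" if f: "f \<in> X" for f
  proof -
    have density: "(\<integral>x. g x \<partial>\<mu>) = (\<integral>x. h x * g x \<partial>\<nu>)" if "g \<in> X" for g
      unfolding \<mu>_def using h_pos by (subst integral_density) (auto simp: meas\<nu> that h_holder less_imp_le)
    have hf: "(\<lambda>x. h x * f x) \<in> X" by (intro X.mult h_holder f)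
    have "(\<lambda>x. h x * P 1 f x) = (\<lambda>x. 1 / \<rho> * L (\<lambda>x. h x * f x) x)"
      using h_pos by (auto simp: P_def less_imp_neq[symmetric])
    then have "(\<integral>x. P 1 f x \<partial>\<mu>) = 1 / \<rho> * (\<integral>x. L (\<lambda>x. h x * f x) x \<partial>\<nu>)"
      by (simp add: density P_in_holder f)
    then show ?thesis using \<rho> by (simp add: conformal[OF hf] density[OF f])
  qed
  have inv: "(\<integral>x. P 1 f x \<partial>\<mu>) = (\<integral>x. f x \<partial>\<mu>)" if f: "continuous_on UNIV f" for f
  proof -
    have small: "\<bar>(\<integral>x. P 1 f x \<partial>\<mu>) - (\<integral>x. f x \<partial>\<mu>)\<bar> \<le> \<epsilon>" if "0 < \<epsilon>" for \<epsilon>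
    proof -
      have pos: "0 < \<epsilon> / 2" using that by simp
      obtain g where g: "g \<in> X" "\<And>x. \<bar>f x - g x\<bar> < \<epsilon> / 2"
        "\<And>n x. \<bar>P n f x - P n g x\<bar> \<le> \<epsilon> / 2" by (rule P_approximation[OF f pos], rule that)
      have c: "continuous_on UNIV g" "continuous_on UNIV (P 1 g)" "continuous_on UNIV (P 1 f)"
        using X.continuous g(1) P_in_holder P_continuous[OF f] by auto
      have close: "\<bar>(\<integral>x. F x \<partial>\<mu>) - (\<integral>x. G x \<partial>\<mu>)\<bar> \<le> \<epsilon> / 2"
        if "continuous_on UNIV F" "continuous_on UNIV G" "\<And>x. \<bar>F x - G x\<bar> \<le> \<epsilon> / 2" for F G :: "'a \<Rightarrow> real"
      proof -
        have "(\<integral>x. F x \<partial>\<mu>) - (\<integral>x. G x \<partial>\<mu>) = (\<integral>x. F x - G x \<partial>\<mu>)"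
          using int that by simp
        also have "\<bar>\<dots>\<bar> \<le> (\<integral>x. \<bar>F x - G x\<bar> \<partial>\<mu>)" by (rule integral_abs_bound)
        also have "\<dots> \<le> (\<integral>x. \<epsilon> / 2 \<partial>\<mu>)"
          using that int by (intro integral_mono) auto
        finally show ?thesis by (simp add: \<mu>.prob_space)
      qed
      have "\<bar>(\<integral>x. P 1 f x \<partial>\<mu>) - (\<integral>x. P 1 g x \<partial>\<mu>)\<bar> \<le> \<epsilon> / 2"
        by (rule close[OF c(3,2) g(3)])
      moreover have "\<bar>(\<integral>x. f x \<partial>\<mu>) - (\<integral>x. g x \<partial>\<mu>)\<bar> \<le> \<epsilon> / 2"
        by (rule close[OF f c(1) less_imp_le[OF g(2)]])
      ultimately show ?thesis using inv_X[OF g(1)] by linarith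
    qed
    have "\<bar>(\<integral>x. P 1 f x \<partial>\<mu>) - (\<integral>x. f x \<partial>\<mu>)\<bar> \<le> 0"
      by (rule field_le_epsilon) (use small in simp)
    then show ?thesis by simp
  qed
  have duality: "(\<integral>x. F x * G ((T ^^ t) x) \<partial>\<mu>) = (\<integral>x. P t F x * G x \<partial>\<mu>)"
    if "continuous_on UNIV F" "continuous_on UNIV G" for F G t
    using that(2)
  proof (induction t arbitrary: G)
    case 0
    then show ?case by (simp add: P_zero)
  next
    case (Suc t)
    have GT: "continuous_on UNIV (\<lambda>x. G (T x))"
      using continuous_on_compose2[OF Suc.prems continuous_T] by simp
    have PF: "continuous_on UNIV (P t F)" by (rule P_continuous[OF that(1)])
    have "(\<integral>x. F x * G ((T ^^ Suc t) x) \<partial>\<mu>) = (\<integral>x. P t F x * G (T x) \<partial>\<mu>)"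
      using Suc.IH[OF GT] by simp
    also have "\<dots> = (\<integral>x. P 1 (\<lambda>x. P t F x * G (T x)) x \<partial>\<mu>)"
      by (intro inv[symmetric] continuous_on_mult PF GT)
    also have "\<dots> = (\<integral>x. P (Suc t) F x * G x \<partial>\<mu>)"
      unfolding P_comp_T using P_comp[of 1 t F] by simp
    finally show ?case .
  qed
  \<comment> \<open>Testing duality on the ring identifies two finite measures, and the resulting
    equality applies to observables that are only integrable.\<close>
  have distr_eq: "distr (density \<mu> F) borel (T ^^ t) = density \<mu> (P t F)"
    if F: "continuous_on UNIV F" "\<And>x. 0 \<le> F x" for F :: "'a \<Rightarrow> real" and t
  proof (rule X.measure_eqI_integral)
    have T_meas: "T ^^ t \<in> measurable (density \<mu> F) borel"
      using borel_measurable_continuous_onI[OF continuous_T_iterate[of t]]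
      by (simp add: measurable_cong_sets[OF sets refl])
    have finite_density: "finite_measure (density \<mu> G)"
      if "continuous_on UNIV G" "\<And>x. 0 \<le> G x" for G :: "'a \<Rightarrow> real"
    proof (rule finite_measureI)
      have "emeasure (density \<mu> G) (space (density \<mu> G)) = (\<integral>\<^sup>+x. ennreal (G x) \<partial>\<mu>)"
        using meas[OF that(1)] by (simp add: emeasure_density cong: nn_integral_cong)
      also have "\<dots> = ennreal (\<integral>x. G x \<partial>\<mu>)"
        using int[OF that(1)] that(2) by (intro nn_integral_eq_integral) auto
      finally show "emeasure (density \<mu> G) (space (density \<mu> G)) \<noteq> \<infinity>" by simp
    qed
    show "finite_measure (density \<mu> (P t F))" by (intro finite_density P_continuous F P_nonneg)
    show "finite_measure (distr (density \<mu> F) borel (T ^^ t))"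
      by (rule finite_measure.finite_measure_distr[OF finite_density[OF F] T_meas])
    show "sets (density \<mu> (P t F)) = sets borel" by (simp add: sets)
    fix G assume G: "G \<in> X"
    have "(\<integral>x. G x \<partial>distr (density \<mu> F) borel (T ^^ t)) = (\<integral>x. G ((T ^^ t) x) \<partial>density \<mu> F)"
      by (rule integral_distr[OF T_meas X.borel[OF G]])
    also have "\<dots> = (\<integral>x. F x * G ((T ^^ t) x) \<partial>\<mu>)"
      using F continuous_on_compose2[OF X.continuous[OF G] continuous_T_iterate[of t]]
      by (subst integral_density) (auto intro!: meas)
    also have "\<dots> = (\<integral>x. P t F x * G x \<partial>\<mu>)" by (rule duality[OF F(1) X.continuous[OF G]])
    also have "\<dots> = (\<integral>x. G x \<partial>density \<mu> (P t F))"
      using P_nonneg[OF F(2)]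
      by (subst integral_density) (auto intro!: meas X.continuous[OF G] P_continuous F)
    finally show "(\<integral>x. G x \<partial>distr (density \<mu> F) borel (T ^^ t)) = (\<integral>x. G x \<partial>density \<mu> (P t F))" .
  qed simp
  obtain B where B: "0 \<le> B" "\<forall>f H n x y. 0 \<le> H \<longrightarrow> (\<forall>x y. \<bar>f x - f y\<bar> \<le> H * w (dist x y)) \<longrightarrow> 1 \<le> n \<longrightarrow>
      \<bar>P n f x - P n f y\<bar> \<le> B * H * real n powr (-\<alpha>)"
    by (rule P_decay, rule that)
  have "\<bar>(\<integral>x. f x * g ((T ^^ t) x) \<partial>\<mu>) - (\<integral>x. f x \<partial>\<mu>) * (\<integral>x. g x \<partial>\<mu>)\<bar>
      \<le> B * holder_const w f * (\<integral>x. \<bar>g x\<bar> \<partial>\<mu>) / real t powr \<alpha>"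
    if f: "f \<in> X" and g: "integrable \<mu> g" and t: "1 \<le> t" for f g t
  proof -
    have g_meas: "g \<in> borel_measurable borel"
      using borel_measurable_integrable[OF g] by (simp add: measurable_cong_sets[OF sets refl])
    have T_meas: "T ^^ t \<in> measurable \<mu> borel"
      using borel_measurable_continuous_onI[OF continuous_T_iterate[of t]]
      by (simp add: measurable_cong_sets[OF sets refl])
    have gT_meas: "(\<lambda>x. g ((T ^^ t) x)) \<in> borel_measurable \<mu>"
      by (rule measurable_compose[OF T_meas g_meas])
    have g_meas': "g \<in> borel_measurable \<mu>" using borel_measurable_integrable[OF g] .
    obtain M where M: "0 \<le> M" "\<And>x. \<bar>f x\<bar> \<le> M" by (rule holder_bounded[OF f], rule that)
    \<comment> \<open>\<open>density\<close> needs a nonnegative function. Adding \<open>M\<close>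
      leaves all differences of values unchanged and shifts both terms of the correlation by
      \<open>M * (\<integral>x. g x \<partial>\<mu>)\<close>.\<close>
    define F where "F x = f x + M" for x
    have F0: "0 \<le> F x" for x using M(2)[of x] by (simp add: F_def abs_le_iff)
    have F: "F \<in> X" unfolding F_def[abs_def] by (intro X.add X.const f)
    note F_cont = X.continuous[OF F]
    have PF_cont: "continuous_on UNIV (P t F)" by (rule P_continuous[OF F_cont])
    \<comment> \<open>The density \<open>1\<close> gives invariance of \<open>\<mu>\<close> under
      \<open>T\<close>.\<close>
    have one: "distr \<mu> borel (T ^^ t) = \<mu>"
      using distr_eq[of "\<lambda>_. 1" t] by (simp add: P_const density_1)
    have gT_int: "integrable \<mu> (\<lambda>x. g ((T ^^ t) x))"
      using g integrable_distr_eq[OF T_meas g_meas] one by simp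
    have gT: "(\<integral>x. g ((T ^^ t) x) \<partial>\<mu>) = (\<integral>x. g x \<partial>\<mu>)"
      using integral_distr[OF T_meas g_meas] one by simp
    have bounded_mult: "integrable \<mu> (\<lambda>x. G x * k x)" if G: "continuous_on UNIV G" and k: "integrable \<mu> k"
      for G k :: "'a \<Rightarrow> real"
    proof -
      obtain N where N: "0 < N" "\<And>x. \<bar>G x\<bar> \<le> N" by (rule X.bound[OF G], rule that)
      have "integrable \<mu> (\<lambda>x. N * k x)" using k by simp
      then show ?thesis
      proof (rule Bochner_Integration.integrable_bound)
        show "(\<lambda>x. G x * k x) \<in> borel_measurable \<mu>"
          by (intro borel_measurable_times meas G borel_measurable_integrable[OF k])
        show "AE x in \<mu>. norm (G x * k x) \<le> norm (N * k x)"
          using N by (auto simp: abs_mult intro!: mult_right_mono)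
      qed
    qed
    have FgT: "(\<integral>x. F x * g ((T ^^ t) x) \<partial>\<mu>) = (\<integral>x. P t F x * g x \<partial>\<mu>)"
    proof -
      have T_meas': "T ^^ t \<in> measurable (density \<mu> F) borel" using T_meas by simp
      have "(\<integral>x. F x * g ((T ^^ t) x) \<partial>\<mu>) = (\<integral>x. g ((T ^^ t) x) \<partial>density \<mu> F)"
        using F0 gT_meas by (subst integral_density) (auto intro!: meas F_cont)
      also have "\<dots> = (\<integral>x. g x \<partial>distr (density \<mu> F) borel (T ^^ t))"
        by (rule integral_distr[OF T_meas' g_meas, symmetric])
      also have "\<dots> = (\<integral>x. g x \<partial>density \<mu> (P t F))" by (simp only: distr_eq[OF F_cont F0])
      also have "\<dots> = (\<integral>x. P t F x * g x \<partial>\<mu>)"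
        using P_nonneg[OF F0] g_meas' by (subst integral_density) (auto intro!: meas PF_cont)
      finally show ?thesis .
    qed
    define c where "c = (\<integral>x. F x \<partial>\<mu>)"
    define K where "K = B * holder_const w f * real t powr (-\<alpha>)"
    have c_P: "c = (\<integral>x. P t F x \<partial>\<mu>)"
      using duality[OF F_cont, of "\<lambda>_. 1" t] by (simp add: c_def)
    have osc: "\<bar>P t F x - P t F y\<bar> \<le> K" for x y
      using B(2)[rule_format, of "holder_const w f" F t x y] holder_const_bound[OF f] t
      by (simp add: F_def K_def)
    \<comment> \<open>\<open>c\<close> is the average of \<open>P t F\<close>, so the deviation from
      it is at most the oscillation.\<close>
    have dev: "\<bar>P t F x - c\<bar> \<le> K" for x
    proof -
      have "P t F x - c = (\<integral>y. P t F x - P t F y \<partial>\<mu>)"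
        using int[OF PF_cont] by (simp add: c_P \<mu>.prob_space)
      also have "\<bar>\<dots>\<bar> \<le> (\<integral>y. \<bar>P t F x - P t F y\<bar> \<partial>\<mu>)" by (rule integral_abs_bound)
      also have "\<dots> \<le> (\<integral>y. K \<partial>\<mu>)"
        using osc int[OF PF_cont] by (intro integral_mono) auto
      finally show ?thesis by (simp add: \<mu>.prob_space)
    qed
    have "(\<integral>x. f x * g ((T ^^ t) x) \<partial>\<mu>) = (\<integral>x. F x * g ((T ^^ t) x) - M * g ((T ^^ t) x) \<partial>\<mu>)"
      by (simp add: F_def algebra_simps)
    also have "\<dots> = (\<integral>x. P t F x * g x \<partial>\<mu>) - M * (\<integral>x. g x \<partial>\<mu>)"
      using bounded_mult[OF F_cont gT_int] gT_int FgT gT by simp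
    finally have 1: "(\<integral>x. f x * g ((T ^^ t) x) \<partial>\<mu>) = (\<integral>x. P t F x * g x \<partial>\<mu>) - M * (\<integral>x. g x \<partial>\<mu>)" .
    have 2: "(\<integral>x. f x \<partial>\<mu>) = c - M"
      using int[OF X.continuous[OF f]] by (simp add: c_def F_def \<mu>.prob_space)
    have "(\<integral>x. f x * g ((T ^^ t) x) \<partial>\<mu>) - (\<integral>x. f x \<partial>\<mu>) * (\<integral>x. g x \<partial>\<mu>)
        = (\<integral>x. P t F x * g x \<partial>\<mu>) - c * (\<integral>x. g x \<partial>\<mu>)"
      unfolding 1 2 by (simp add: algebra_simps)
    also have "\<dots> = (\<integral>x. (P t F x - c) * g x \<partial>\<mu>)"
      using bounded_mult[OF PF_cont g] g by (simp add: left_diff_distrib)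
    also have "\<bar>\<dots>\<bar> \<le> (\<integral>x. \<bar>(P t F x - c) * g x\<bar> \<partial>\<mu>)" by (rule integral_abs_bound)
    also have "\<dots> \<le> (\<integral>x. K * \<bar>g x\<bar> \<partial>\<mu>)"
    proof (rule integral_mono)
      show "integrable \<mu> (\<lambda>x. \<bar>(P t F x - c) * g x\<bar>)"
        by (intro integrable_abs bounded_mult g continuous_on_diff PF_cont continuous_on_const)
      show "integrable \<mu> (\<lambda>x. K * \<bar>g x\<bar>)" using g by simp
      show "\<bar>(P t F x - c) * g x\<bar> \<le> K * \<bar>g x\<bar>" for x
        unfolding abs_mult by (intro mult_right_mono dev) simp
    qed
    also have "\<dots> = B * holder_const w f * (\<integral>x. \<bar>g x\<bar> \<partial>\<mu>) / real t powr \<alpha>"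
      by (simp add: K_def powr_minus divide_inverse)
    finally show ?thesis .
  qed
  then show ?thesis unfolding polynomial_decay_def \<mu>_def by blast
qed

end

section \<open>Verification of the abstract hypotheses for the given map and potential\<close>

theorem theorem5:
  fixes T :: "'a::metric_space \<Rightarrow> 'a" and A :: "'a \<Rightarrow> real"
    and k :: nat and \<beta> :: real and \<omega> \<omega>' :: "real \<Rightarrow> real"
  assumes "compact (UNIV :: 'a set)"
    and "k_to_one k T" and "uniformly_expanding k T"
    and "\<beta> > 1"
    and "log_modulus \<beta> \<omega>" and "log_modulus (\<beta> - 1) \<omega>'"
    and "A \<in> holder_space \<omega>"
  shows "satisfies_RPF (holder_space \<omega>') (holder_norm \<omega>') (transfer_operator T A) \<and>
    (\<forall>\<mu>. RPF_measure (holder_space \<omega>') (transfer_operator T A) \<mu> \<longrightarrow>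
       polynomial_decay T \<mu> \<omega>' (\<beta> - 1))"
proof -
  obtain \<Lambda> where \<Lambda>: "1 < \<Lambda>" and expand: "\<And>x y. \<exists>xs ys.
      bij_betw xs {1..k} (T -` {x}) \<and> bij_betw ys {1..k} (T -` {y}) \<and>
      (\<forall>j\<in>{1..k}. dist (xs j) (ys j) \<le> dist x y / \<Lambda>)"
    using assms(3) unfolding uniformly_expanding_def by blast
  have fin: "finite (T -` {x})" and card: "card (T -` {x}) = k" for x
    using assms(2) by (auto simp: k_to_one_def)
  \<comment> \<open>Every point is a preimage of its own image, which forces
    \<open>k \<noteq> 0\<close>; equal cardinalities then make all fibres nonempty.\<close>
  have ne: "T -` {x} \<noteq> {}" for x
  proof -
    define p :: 'a where "p = undefined"
    have "p \<in> T -` {T p}" by simp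
    then have "k \<noteq> 0" using card[of "T p"] card_0_eq[OF fin[of "T p"]] by blast
    then show ?thesis using card[of x] by auto
  qed
  have pairing: "\<exists>\<sigma>. bij_betw \<sigma> (T -` {x}) (T -` {y}) \<and> (\<forall>z\<in>T -` {x}. dist z (\<sigma> z) \<le> dist x y / \<Lambda>)" for x y
  proof -
    obtain xs ys where xy: "bij_betw xs {1..k} (T -` {x})" "bij_betw ys {1..k} (T -` {y})"
      "\<forall>j\<in>{1..k}. dist (xs j) (ys j) \<le> dist x y / \<Lambda>" using expand by blast
    show ?thesis
    proof (intro exI conjI ballI)
      show "bij_betw (ys \<circ> inv_into {1..k} xs) (T -` {x}) (T -` {y})"
        by (rule bij_betw_trans[OF bij_betw_inv_into[OF xy(1)] xy(2)])
      fix z assume z: "z \<in> T -` {x}"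
      then have im: "z \<in> xs ` {1..k}" using bij_betw_imp_surj_on[OF xy(1)] by simp
      show "dist z ((ys \<circ> inv_into {1..k} xs) z) \<le> dist x y / \<Lambda>"
        using bspec[OF xy(3) inv_into_into[OF im]] f_inv_into_f[OF im] by simp
    qed
  qed
  obtain D0 where D0: "\<And>x y :: 'a. dist x y \<le> D0"
    using compact_imp_bounded[OF assms(1)] unfolding bounded_two_points by auto
  \<comment> \<open>The maximum with \<open>1\<close> keeps the diameter bound positive on a
    one-point space.\<close>
  define D where "D = max 1 D0"
  have D: "0 < D" "dist x y \<le> D" for x y :: 'a using D0[of x y] by (auto simp: D_def)
  obtain C where C: "\<And>x y. \<bar>A x - A y\<bar> \<le> C * \<omega> (dist x y)"
    using assms(7) unfolding holder_space_def by blast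
  have A: "\<bar>A x - A y\<bar> \<le> \<bar>C\<bar> * \<omega> (dist x y)" for x y
    using C[of x y] mult_right_mono[OF abs_ge_self[of C] log_modulus_nonneg[OF assms(5) zero_le_dist[of x y]]]
    by linarith
  obtain S where S: "0 \<le> S" "\<forall>r n. 0 \<le> r \<longrightarrow> r \<le> D \<longrightarrow> (\<Sum>j<n. \<omega> (r / \<Lambda> ^ Suc j)) \<le> S * \<omega>' r"
    using log_modulus_sum_le[OF assms(4-6) \<Lambda> less_imp_le[OF D(1)]] by blast
  obtain \<kappa> where \<kappa>: "0 \<le> \<kappa>" "\<forall>n\<ge>1. \<omega>' (D / \<Lambda> ^ n) \<le> \<kappa> * real n powr (- (\<beta> - 1))"
    using log_modulus_decay[OF _ assms(6) \<Lambda> less_imp_le[OF D(1)]] assms(4) by auto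
  interpret expanding_transfer T A \<omega> \<omega>' \<Lambda> D "\<bar>C\<bar>" "\<bar>C\<bar> * S" "D / \<omega>' D" \<kappa> "\<beta> - 1"
  proof
    show "\<bar>C\<bar> * (\<Sum>j<n. \<omega> (r / \<Lambda> ^ Suc j)) \<le> \<bar>C\<bar> * S * \<omega>' r" if "0 \<le> r" "r \<le> D" for r n
      unfolding mult.assoc using S(2) that by (intro mult_left_mono) auto
    show "r \<le> D / \<omega>' D * \<omega>' r" if "0 \<le> r" "r \<le> D" for r
      by (rule le_log_modulus[OF assms(6) D(1) that])
    show "\<omega>' (D / \<Lambda> ^ n) \<le> \<kappa> * real n powr - (\<beta> - 1)" if "1 \<le> n" for n
      using \<kappa>(2) that by blast
    show "continuous_on {0..} \<omega>'" "\<omega>' 0 = 0" using assms(6) by (auto simp: log_modulus_def)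
    show "\<omega> r \<le> \<omega> s" if "0 \<le> r" "r \<le> s" for r s by (rule log_modulus_mono[OF assms(5) that])
    show "\<omega>' r \<le> \<omega>' s" if "0 \<le> r" "r \<le> s" for r s by (rule log_modulus_mono[OF assms(6) that])
    show "0 < \<omega>' r" if "0 < r" for r by (rule log_modulus_pos[OF assms(6) that])
    show "0 \<le> \<bar>C\<bar> * S" using S(1) by simp
  qed (use assms(1,4) fin ne \<Lambda> pairing A D \<kappa>(1) in auto)
  obtain h \<rho> where h: "h \<in> X" "\<And>x. 0 < h x" "0 < \<rho>" "\<And>x. L h x = \<rho> * h x"
    by (rule eigenfunction_exists, rule that)
  interpret E: eigenfunction T A \<omega> \<omega>' \<Lambda> D "\<bar>C\<bar>" "\<bar>C\<bar> * S" "D / \<omega>' D" \<kappa> "\<beta> - 1" h \<rho>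
    by unfold_locales (use h in auto)
  obtain \<nu> where "rpf_triple X L h \<rho> \<nu>" by (rule E.rpf_triple_exists, rule that)
  then have "satisfies_RPF X (holder_norm \<omega>') L"
    unfolding satisfies_RPF_def using acts_continuously_L by blast
  moreover have "polynomial_decay T \<mu> \<omega>' (\<beta> - 1)" if \<mu>: "RPF_measure X L \<mu>" for \<mu>
  proof -
    obtain h' \<rho>' \<nu>' where triple: "rpf_triple X L h' \<rho>' \<nu>'" and dens: "\<mu> = density \<nu>' (\<lambda>x. ennreal (h' x))"
      and prob: "prob_space \<mu>"
      using \<mu> unfolding RPF_measure_def by blast
    \<comment> \<open>The eigenfunction of the given triple replaces the constructed one, so no
      uniqueness statement has to be proved.\<close>
    interpret F: eigenfunction T A \<omega> \<omega>' \<Lambda> D "\<bar>C\<bar>" "\<bar>C\<bar> * S" "D / \<omega>' D" \<kappa> "\<beta> - 1" h' \<rho>'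
      using triple by unfold_locales (auto simp: rpf_triple_def)
    show ?thesis using F.polynomial_decay_density[OF triple] prob dens by simp
  qed
  ultimately show ?thesis by blast
qed

end
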